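(* For $n\ge 5$, the groups ${\rm Aut}(\mathbf{F}_n)$, ${\rm Aut}^+(\mathbf{F}_n)$, ${\rm Out}(\mathbf{F}_n)$, ${\rm Out}^+(\mathbf{F}_n)$, and ${\rm SL}(n,\mathbf{Z})$ are one-ended.
   Context: $\mathbf{F}_n$ is the free group on $n$ generators, ${\rm Aut}(\mathbf{F}_n)$ its automorphism group, ${\rm Inn}(\mathbf{F}_n)$ its group of inner automorphisms and ${\rm Out}(\mathbf{F}_n)={\rm Aut}(\mathbf{F}_n)/{\rm Inn}(\mathbf{F}_n)$. Abelianisation gives a surjective homomorphism ${\rm Aut}(\mathbf{F}_n)\to {\rm Aut}(\mathbf{Z}^n)={\rm GL}(n,\mathbf{Z})$; composing with the determinant ${\rm GL}(n,\mathbf{Z})\to\{\pm1\}$ gives $\varphi:{\rm Aut}(\mathbf{F}_n)\to\{\pm 1\}$. The special automorphism group is ${\rm Aut}^+(\mathbf{F}_n)=\ker(\varphi)$, and the special outer automorphism group is ${\rm Out}^+(\mathbf{F}_n)={\rm Aut}^+(\mathbf{F}_n)/{\rm Inn}(\mathbf{F}_n)$. One end: a finitely generated infinite group $G$ is one-ended (has one end) if for some (equivalently every) finite generating set $T$, for every $k$ the complement in the Cayley graph ${\rm Cay}(G,T)$ of the ball of radius $k$ about the identity has exactly one unbounded connected component. *)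

theory Defs
  imports
    "HOL-Algebra.Bij"
    "HOL-Algebra.Coset"
    "HOL-Algebra.Generated_Groups"
    "Jordan_Normal_Form.Determinant"
begin

section \<open>Free groups as groups of reduced words\<close>

text \<open>A letter \<open>(i, True)\<close> stands for the generator \<open>x\<^sub>i\<close> and \<open>(i, False)\<close> for its inverse.\<close>

type_synonym letter = "nat \<times> bool"
type_synonym word = "letter list"

definition inv_letter :: "letter \<Rightarrow> letter" where
  "inv_letter a = (fst a, \<not> snd a)"

definition reduced :: "word \<Rightarrow> bool" where
  "reduced = successively (\<lambda>a b. b \<noteq> inv_letter a)"

fun letter_mult :: "letter \<Rightarrow> word \<Rightarrow> word" where
  "letter_mult a [] = [a]"
| "letter_mult a (b # w) = (if b = inv_letter a then w else a # b # w)"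

definition free_group :: "nat \<Rightarrow> word monoid" where
  "free_group n =
     \<lparr>carrier = {w \<in> lists ({..<n} \<times> UNIV). reduced w},
      monoid.mult = foldr letter_mult,
      one = []\<rparr>"

lemma inv_letter_inv_letter [simp]: "inv_letter (inv_letter a) = a"
  by (simp add: inv_letter_def)

lemma reduced_Nil [simp]: "reduced []"
  by (simp add: reduced_def)

lemma reduced_Cons: "reduced (a # w) \<longleftrightarrow> (w = [] \<or> hd w \<noteq> inv_letter a) \<and> reduced w"
  by (auto simp: reduced_def successively_Cons)

lemma reduced_letter_mult: "reduced w \<Longrightarrow> reduced (letter_mult a w)"
  by (cases w) (auto simp: reduced_Cons)

lemma letter_mult_cancel: "reduced w \<Longrightarrow> letter_mult a (letter_mult (inv_letter a) w) = w"
  by (cases w; cases "tl w") (auto simp: reduced_Cons)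

lemma reduced_foldr: "reduced v \<Longrightarrow> reduced (foldr letter_mult u v)"
  by (induction u) (auto simp: reduced_letter_mult)

lemma foldr_letter_mult:
  assumes "reduced z" "reduced w"
  shows "foldr letter_mult (letter_mult a z) w = letter_mult a (foldr letter_mult z w)"
  using assms by (cases z) (auto simp: letter_mult_cancel reduced_foldr)

lemma foldr_letter_mult_assoc:
  assumes "reduced v" "reduced w"
  shows "foldr letter_mult (foldr letter_mult u v) w = foldr letter_mult u (foldr letter_mult v w)"
  using assms by (induction u) (auto simp: foldr_letter_mult reduced_foldr)

lemma foldr_letter_mult_Nil: "reduced u \<Longrightarrow> foldr letter_mult u [] = u"
proof (induction u)
  case (Cons a u)
  then show ?case by (cases u) (auto simp: reduced_Cons)
qed simp

lemma letter_mult_in_lists: "a \<in> A \<Longrightarrow> w \<in> lists A \<Longrightarrow> letter_mult a w \<in> lists A"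
  by (cases w) auto

lemma foldr_letter_mult_in_lists:
  "u \<in> lists A \<Longrightarrow> v \<in> lists A \<Longrightarrow> foldr letter_mult u v \<in> lists A"
  by (induction u) (simp_all add: letter_mult_in_lists del: in_lists_conv_set)

lemma foldr_inverse:
  assumes "reduced w"
  shows "foldr letter_mult (rev (map inv_letter u)) (foldr letter_mult u w) = w"
  using assms
proof (induction u arbitrary: w)
  case (Cons a u)
  have "letter_mult (inv_letter a) (letter_mult a (foldr letter_mult u w)) = foldr letter_mult u w"
    using letter_mult_cancel[of _ "inv_letter a"] Cons.prems by (simp add: reduced_foldr)
  then show ?case using Cons by simp
qed simp

lemma reduced_inverse: "reduced u \<Longrightarrow> reduced (rev (map inv_letter u))"
  unfolding reduced_def
  by (auto simp: successively_map elim!: successively_mono)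

lemma group_free_group: "group (free_group n)"
proof (rule groupI)
  fix x assume x: "x \<in> carrier (free_group n)"
  then have "rev (map inv_letter x) \<in> carrier (free_group n)"
    by (fastforce simp: free_group_def reduced_inverse inv_letter_def)
  moreover have "foldr letter_mult (rev (map inv_letter x)) x = []"
    using x foldr_inverse[of "[]" x] by (simp add: free_group_def foldr_letter_mult_Nil)
  ultimately show "\<exists>y\<in>carrier (free_group n). y \<otimes>\<^bsub>free_group n\<^esub> x = \<one>\<^bsub>free_group n\<^esub>"
    by (auto simp: free_group_def)
qed (simp_all add: free_group_def reduced_foldr foldr_letter_mult_assoc
       foldr_letter_mult_in_lists del: in_lists_conv_set)


section \<open>Special automorphisms and outer automorphisms\<close>

definition Inn :: "('a, 'b) monoid_scheme \<Rightarrow> ('a \<Rightarrow> 'a) set" where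
  "Inn G = (\<lambda>g. \<lambda>x\<in>carrier G. g \<otimes>\<^bsub>G\<^esub> x \<otimes>\<^bsub>G\<^esub> inv\<^bsub>G\<^esub> g) ` carrier G"

definition exponent_sum :: "nat \<Rightarrow> word \<Rightarrow> int" where
  "exponent_sum i w = (\<Sum>a\<leftarrow>w. if fst a = i then (if snd a then 1 else - 1) else 0)"

definition abelianise :: "nat \<Rightarrow> word \<Rightarrow> int vec" where
  "abelianise n w = vec n (\<lambda>i. exponent_sum i w)"

text \<open>The matrix, in the standard basis, of the endomorphism of \<open>\<int>\<^sup>n\<close> induced by \<open>f\<close>; see
  \<open>abelianise_apply\<close> below.\<close>

definition abelianised_mat :: "nat \<Rightarrow> (word \<Rightarrow> word) \<Rightarrow> int mat" where
  "abelianised_mat n f = mat_of_cols n (map (\<lambda>j. abelianise n (f [(j, True)])) [0..<n])"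

definition aut_sign :: "nat \<Rightarrow> (word \<Rightarrow> word) \<Rightarrow> int" where
  "aut_sign n f = det (abelianised_mat n f)"

definition AutF :: "nat \<Rightarrow> (word \<Rightarrow> word) monoid" where
  "AutF n = AutoGroup (free_group n)"

definition SAutF :: "nat \<Rightarrow> (word \<Rightarrow> word) monoid" where
  "SAutF n = AutF n \<lparr>carrier := {f \<in> carrier (AutF n). aut_sign n f = 1}\<rparr>"

definition OutF :: "nat \<Rightarrow> (word \<Rightarrow> word) set monoid" where
  "OutF n = AutF n Mod Inn (free_group n)"

definition SOutF :: "nat \<Rightarrow> (word \<Rightarrow> word) set monoid" where
  "SOutF n = SAutF n Mod Inn (free_group n)"

definition SL_int :: "nat \<Rightarrow> int mat monoid" where
  "SL_int n = \<lparr>carrier = {A \<in> carrier_mat n n. det A = 1}, monoid.mult = (*), one = 1\<^sub>m n\<rparr>"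

lemma exponent_sum_letter_mult:
  "exponent_sum i (letter_mult a w) = exponent_sum i [a] + exponent_sum i w"
  by (cases w) (auto simp: exponent_sum_def inv_letter_def)

lemma exponent_sum_mult:
  "exponent_sum i (u \<otimes>\<^bsub>free_group n\<^esub> v) = exponent_sum i u + exponent_sum i v"
proof -
  have "exponent_sum i (foldr letter_mult u v) = exponent_sum i u + exponent_sum i v"
    by (induction u) (auto simp: exponent_sum_letter_mult, auto simp: exponent_sum_def)
  then show ?thesis by (simp add: free_group_def)
qed

lemma abelianise_mult:
  "abelianise n (u \<otimes>\<^bsub>free_group n\<^esub> v) = abelianise n u + abelianise n v"
  by (auto simp: abelianise_def exponent_sum_mult)

lemma exponent_sum_hom_letter:
  assumes f: "f \<in> hom (free_group n) (free_group n)" and j: "j < n"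
  shows "exponent_sum i (f [(j, b)]) = (if b then 1 else - 1) * exponent_sum i (f [(j, True)])"
proof (cases b)
  case False
  interpret F: group "free_group n" by (rule group_free_group)
  have c: "[(j, c)] \<in> carrier (free_group n)" for c
    using j by (simp add: free_group_def reduced_Cons)
  have one: "f \<one>\<^bsub>free_group n\<^esub> = \<one>\<^bsub>free_group n\<^esub>"
    by (rule hom_one[OF f F.is_group F.is_group])
  have "[(j, True)] \<otimes>\<^bsub>free_group n\<^esub> [(j, False)] = \<one>\<^bsub>free_group n\<^esub>"
    by (simp add: free_group_def inv_letter_def)
  then have "f [(j, True)] \<otimes>\<^bsub>free_group n\<^esub> f [(j, False)] = \<one>\<^bsub>free_group n\<^esub>"
    using hom_mult[OF f c c, of True False] one by simp
  then have "exponent_sum i (f [(j, True)]) + exponent_sum i (f [(j, False)]) = 0"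
    using exponent_sum_mult[of i n "f [(j, True)]" "f [(j, False)]"]
    by (simp add: free_group_def exponent_sum_def)
  then show ?thesis using False by simp
qed simp

lemma exponent_sum_hom:
  assumes f: "f \<in> hom (free_group n) (free_group n)" and w: "w \<in> carrier (free_group n)"
  shows "exponent_sum i (f w) = (\<Sum>j<n. exponent_sum i (f [(j, True)]) * exponent_sum j w)"
  using w
proof (induction w)
  case Nil
  interpret F: group "free_group n" by (rule group_free_group)
  have "f [] = []"
    using hom_one[OF f F.is_group F.is_group] by (simp add: free_group_def)
  then show ?case by (simp add: exponent_sum_def)
next
  case (Cons a w)
  obtain k b where a: "a = (k, b)" by (cases a)
  have k: "k < n" and w: "w \<in> carrier (free_group n)" and ac: "[a] \<in> carrier (free_group n)"
    using Cons.prems by (auto simp: free_group_def a reduced_Cons)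
  have "[a] \<otimes>\<^bsub>free_group n\<^esub> w = a # w"
    using Cons.prems by (cases w) (auto simp: free_group_def reduced_Cons)
  then have "f (a # w) = f [a] \<otimes>\<^bsub>free_group n\<^esub> f w"
    using hom_mult[OF f ac w] by simp
  then have "exponent_sum i (f (a # w)) = exponent_sum i (f [a]) + exponent_sum i (f w)"
    by (simp add: exponent_sum_mult)
  also have "exponent_sum i (f [a]) =
      (\<Sum>j<n. exponent_sum i (f [(j, True)]) * exponent_sum j [a])"
  proof -
    have "(\<Sum>j<n. exponent_sum i (f [(j, True)]) * exponent_sum j [a]) =
        (\<Sum>j<n. if j = k then (if b then 1 else - 1) * exponent_sum i (f [(j, True)]) else 0)"
      by (rule sum.cong) (auto simp: exponent_sum_def a)
    then show ?thesis
      using k exponent_sum_hom_letter[OF f k, of i b] by (simp add: a)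
  qed
  also have "exponent_sum i (f w) =
      (\<Sum>j<n. exponent_sum i (f [(j, True)]) * exponent_sum j w)"
    by (rule Cons.IH[OF w])
  also have "(\<Sum>j<n. exponent_sum i (f [(j, True)]) * exponent_sum j [a]) + \<dots> =
      (\<Sum>j<n. exponent_sum i (f [(j, True)]) * exponent_sum j (a # w))"
    by (simp add: sum.distrib[symmetric] exponent_sum_def algebra_simps)
  finally show ?case .
qed

lemma abelianise_apply:
  assumes "f \<in> hom (free_group n) (free_group n)" "w \<in> carrier (free_group n)"
  shows "abelianise n (f w) = abelianised_mat n f *\<^sub>v abelianise n w"
  using exponent_sum_hom[OF assms]
  by (auto simp: abelianise_def abelianised_mat_def mat_of_cols_index scalar_prod_def
      lessThan_atLeast0)


section \<open>Cayley graphs and one-endedness\<close>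

definition cayley_adj :: "('a, 'b) monoid_scheme \<Rightarrow> 'a set \<Rightarrow> 'a rel" where
  "cayley_adj G T =
     {(x, y) \<in> carrier G \<times> carrier G. \<exists>t\<in>T. y = x \<otimes>\<^bsub>G\<^esub> t \<or> x = y \<otimes>\<^bsub>G\<^esub> t}"

definition cayley_ball :: "('a, 'b) monoid_scheme \<Rightarrow> 'a set \<Rightarrow> nat \<Rightarrow> 'a set" where
  "cayley_ball G T k = {x. \<exists>m\<le>k. (\<one>\<^bsub>G\<^esub>, x) \<in> cayley_adj G T ^^ m}"

text \<open>Vertex sets of the connected components of the subgraph of the Cayley graph induced on \<open>S\<close>.\<close>

definition cayley_components :: "('a, 'b) monoid_scheme \<Rightarrow> 'a set \<Rightarrow> 'a set \<Rightarrow> 'a set set" where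
  "cayley_components G T S = S // Restr ((Restr (cayley_adj G T) S)\<^sup>*) S"

definition cayley_bounded :: "('a, 'b) monoid_scheme \<Rightarrow> 'a set \<Rightarrow> 'a set \<Rightarrow> bool" where
  "cayley_bounded G T U \<longleftrightarrow> (\<exists>r. U \<subseteq> cayley_ball G T r)"

definition one_ended :: "('a, 'b) monoid_scheme \<Rightarrow> bool" where
  "one_ended G \<longleftrightarrow> group G \<and> infinite (carrier G) \<and>
     (\<exists>T. finite T \<and> T \<subseteq> carrier G \<and> generate G T = carrier G \<and>
       (\<forall>k. \<exists>!U. U \<in> cayley_components G T (carrier G - cayley_ball G T k) \<and>
                 \<not> cayley_bounded G T U))"

end

theory Submission
  imports Defs
begin

text \<open>
  A ray \<open>g, g s, g s\<^sup>2, \<dots>\<close> in the direction of a generator \<open>s\<close> of infinite order leaves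
  every ball, and if \<open>s\<close> and \<open>t\<close> generate a free abelian semigroup of rank two, then the
  rays from \<open>g\<close> in the directions \<open>s\<close> and \<open>t\<close> are joined far out inside a quarter plane. Hence, if
  any two of the generators are linked by a generator independent of both, all rays end in the
  same component of the complement of a ball. Moreover only finitely many points of the complement
  have both their \<open>s\<close>-ray and their \<open>t\<close>-ray meeting the ball, so that component is the only
  infinite one. Transvections of \<open>F\<^sub>n\<close> are linked in this way when \<open>n \<ge> 5\<close>, independence being
  visible on the abelianisation, and they generate the special automorphism group by Nielsen's
  reduction; all the groups in question are images of it or of the full automorphism group.
\<close>

section \<open>A criterion for one-endedness\<close>

text \<open>The number 5 counts indices: two transvections involve at most four, and the one linking
  them has to move a generator outside these, while its multiplier may coincide with one of theirs.
  Independence concerns nonnegative exponents only, as rays run one way. It is certified by an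
  invariant, the abelianised matrix, that is constant on the fibres of every homomorphism in play
  (identity, quotient by inner automorphisms, abelianisation); hence it is proved once, for
  automorphisms, and survives in each image. A generator of determinant -1, which the two full
  groups require, has order two and gives no ray. Therefore ray directions come from a subset
  \<open>S\<close> of the generators, and any generator \<open>y\<close> has to satisfy
  \<open>y s = s' y\<close> for some \<open>s\<close>, \<open>s'\<close> in \<open>S\<close>: then
  right translation by \<open>y\<close> carries a ray to another one running alongside it. In
  Nielsen's reduction length alone is too weak a measure, since the image of a letter may be
  absorbed half from the left and half from the right; a lexicographic second measure excludes this.
  That abelianisation maps onto the special linear group is a separate Euclidean reduction by
  columns.\<close>

definition indep_commuting :: "('a, 'b) monoid_scheme \<Rightarrow> 'a \<Rightarrow> 'a \<Rightarrow> bool" where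
  "indep_commuting G s t \<longleftrightarrow> s \<otimes>\<^bsub>G\<^esub> t = t \<otimes>\<^bsub>G\<^esub> s \<and>
     inj (\<lambda>(i::nat, j::nat). s [^]\<^bsub>G\<^esub> i \<otimes>\<^bsub>G\<^esub> t [^]\<^bsub>G\<^esub> j)"

lemma (in group) pow_commute:
  assumes "s \<in> carrier G" "t \<in> carrier G" "s \<otimes> t = t \<otimes> s"
  shows "s [^] (i::nat) \<otimes> t [^] (j::nat) = t [^] j \<otimes> s [^] i"
  using assms by (metis group_commutes_pow nat_pow_closed)

text \<open>Only \<open>S\<close> supplies directions of rays, which leaves room in \<open>T\<close>
  for a generator of finite order. The case \<open>s = s'\<close> of \<open>link\<close> already
  forces infinite order, and \<open>conjugate\<close> lets a ray follow its base point across an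
  edge labelled \<open>y\<close>; for \<open>y\<close> in \<open>S\<close> it holds with
  \<open>s = s' = y\<close>.\<close>

locale linked_generators = group G for G (structure) +
  fixes T S :: "'a set"
  assumes finite_T: "finite T" and T_carrier: "T \<subseteq> carrier G"
    and generate_T: "generate G T = carrier G"
    and S_T: "S \<subseteq> T" and S_nonempty: "S \<noteq> {}"
    and link: "\<And>s s'. s \<in> S \<Longrightarrow> s' \<in> S \<Longrightarrow>
      \<exists>u\<in>S. indep_commuting G s u \<and> indep_commuting G u s'"
    and conjugate: "\<And>y. y \<in> T \<Longrightarrow> \<exists>s\<in>S. \<exists>s'\<in>S. y \<otimes> s = s' \<otimes> y"
begin

lemma S_carrier: "s \<in> S \<Longrightarrow> s \<in> carrier G"
  using S_T T_carrier by blast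

section \<open>Finite balls and connectedness of the Cayley graph\<close>

lemma adj_mult: "x \<in> carrier G \<Longrightarrow> t \<in> T \<Longrightarrow> (x, x \<otimes> t) \<in> cayley_adj G T"
  using T_carrier by (auto simp: cayley_adj_def)

lemma sym_adj: "sym (cayley_adj G T)"
  by (auto simp: sym_def cayley_adj_def)

lemma finite_adj: "finite (cayley_adj G T `` {x})"
proof -
  have "cayley_adj G T `` {x} \<subseteq> (\<lambda>t. x \<otimes> t) ` T \<union> (\<lambda>t. x \<otimes> inv t) ` T"
    using T_carrier by (force simp: cayley_adj_def m_assoc)
  then show ?thesis using finite_T by (auto intro: finite_subset)
qed

lemma finite_sphere: "finite {x. (\<one>, x) \<in> cayley_adj G T ^^ m}"
proof (induction m)
  case (Suc m)
  have "{x. (\<one>, x) \<in> cayley_adj G T ^^ Suc m} =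
      (\<Union>y\<in>{x. (\<one>, x) \<in> cayley_adj G T ^^ m}. cayley_adj G T `` {y})"
    by auto
  then show ?case using Suc finite_adj by simp
qed simp

lemma finite_ball: "finite (cayley_ball G T k)"
proof -
  have "cayley_ball G T k = (\<Union>m\<le>k. {x. (\<one>, x) \<in> cayley_adj G T ^^ m})"
    by (auto simp: cayley_ball_def)
  then show ?thesis using finite_sphere by simp
qed

lemma connected: "x \<in> carrier G \<Longrightarrow> g \<in> carrier G \<Longrightarrow> (g, g \<otimes> x) \<in> (cayley_adj G T)\<^sup>*"
proof -
  have "x \<in> generate G T \<Longrightarrow> \<forall>g\<in>carrier G. (g, g \<otimes> x) \<in> (cayley_adj G T)\<^sup>*"
  proof (induction x rule: generate.induct)
    case (incl h)
    then show ?case by (auto intro: adj_mult)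
  next
    case (inv h)
    show ?case
    proof
      fix g assume g: "g \<in> carrier G"
      have "(g \<otimes> inv h, g \<otimes> inv h \<otimes> h) \<in> cayley_adj G T"
        using g inv T_carrier by (intro adj_mult) auto
      then have "(g \<otimes> inv h, g) \<in> cayley_adj G T"
        using g inv T_carrier by (auto simp: m_assoc subset_iff)
      then show "(g, g \<otimes> inv h) \<in> (cayley_adj G T)\<^sup>*"
        using sym_adj by (auto simp: sym_def)
    qed
  next
    case (eng h1 h2)
    have h: "h1 \<in> carrier G" "h2 \<in> carrier G"
      using eng.hyps generate_T by auto
    show ?case
    proof
      fix g assume g: "g \<in> carrier G"
      have "(g, g \<otimes> h1) \<in> (cayley_adj G T)\<^sup>*" "(g \<otimes> h1, g \<otimes> h1 \<otimes> h2) \<in> (cayley_adj G T)\<^sup>*"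
        using eng.IH g h by auto
      then show "(g, g \<otimes> (h1 \<otimes> h2)) \<in> (cayley_adj G T)\<^sup>*"
        using g h by (simp add: m_assoc)
    qed
  qed simp
  then show "x \<in> carrier G \<Longrightarrow> g \<in> carrier G \<Longrightarrow> (g, g \<otimes> x) \<in> (cayley_adj G T)\<^sup>*"
    using generate_T by blast
qed

lemma mem_ball: "x \<in> carrier G \<Longrightarrow> \<exists>k. x \<in> cayley_ball G T k"
  using connected[of x \<one>] by (auto simp: cayley_ball_def rtrancl_is_UN_relpow)

lemma bounded_iff_finite:
  assumes "U \<subseteq> carrier G"
  shows "cayley_bounded G T U \<longleftrightarrow> finite U"
proof
  assume "cayley_bounded G T U"
  then show "finite U" by (auto simp: cayley_bounded_def intro: finite_subset finite_ball)
next
  assume "finite U"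
  obtain k where k: "x \<in> cayley_ball G T (k x)" if "x \<in> carrier G" for x
    using mem_ball by metis
  have "x \<in> cayley_ball G T (Max (k ` U))" if "x \<in> U" for x
  proof -
    have "k x \<le> Max (k ` U)" using that \<open>finite U\<close> by auto
    moreover have "x \<in> cayley_ball G T (k x)" using k assms that by blast
    then obtain m where "m \<le> k x" "(\<one>, x) \<in> cayley_adj G T ^^ m"
      unfolding cayley_ball_def by blast
    ultimately show ?thesis unfolding cayley_ball_def using order_trans by blast
  qed
  then show "cayley_bounded G T U" by (auto simp: cayley_bounded_def)
qed

lemma inj_pow:
  assumes "s \<in> S"
  shows "inj (\<lambda>i::nat. s [^] i)"
proof (rule injI)
  fix i j :: nat
  assume eq: "s [^] i = s [^] j"
  obtain u where "u \<in> S" "indep_commuting G s u" using link[OF assms assms] by blast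
  then have "inj (\<lambda>(i::nat, j::nat). s [^] i \<otimes> u [^] j)" by (simp add: indep_commuting_def)
  then show "i = j" using eq by (auto dest!: injD[of _ "(i, 0)" "(j, 0)"])
qed

lemma infinite_carrier: "infinite (carrier G)"
proof -
  obtain s where "s \<in> S" using S_nonempty by blast
  then have "infinite (range (\<lambda>i::nat. s [^] i))" "range (\<lambda>i::nat. s [^] i) \<subseteq> carrier G"
    using inj_pow range_inj_infinite S_carrier by auto
  then show ?thesis using finite_subset by blast
qed

section \<open>Rays in the complement of a finite set\<close>

context
  fixes K :: "'a set"
  assumes finite_K: "finite K"
begin

abbreviation V where "V \<equiv> carrier G - K"
abbreviation joined where "joined \<equiv> (Restr (cayley_adj G T) V)\<^sup>*"

text \<open>Here \<open>x\<close> stands for its component. Membership in \<open>V\<close> is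
  demanded separately because \<open>joined\<close> is a reflexive closure and so relates points of
  \<open>K\<close> to themselves.\<close>

definition ends_at :: "'a \<Rightarrow> 'a \<Rightarrow> 'a \<Rightarrow> bool" where
  "ends_at g s x \<longleftrightarrow> (\<exists>N::nat. \<forall>i\<ge>N. g \<otimes> s [^] i \<in> V \<and> (g \<otimes> s [^] i, x) \<in> joined)"

lemma joined_sym: "(x, y) \<in> joined \<Longrightarrow> (y, x) \<in> joined"
proof -
  have "sym joined" using sym_adj by (intro sym_rtrancl) (auto simp: sym_def)
  then show "(x, y) \<in> joined \<Longrightarrow> (y, x) \<in> joined" by (rule symD)
qed

lemma joined_path:
  assumes "N \<le> M" "\<And>i. N \<le> i \<Longrightarrow> i < M \<Longrightarrow> (p i, p (Suc i)) \<in> cayley_adj G T"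
    "\<And>i. N \<le> i \<Longrightarrow> i \<le> M \<Longrightarrow> p i \<in> V"
  shows "(p N, p M) \<in> joined"
  using assms
proof (induction M rule: dec_induct)
  case (step M)
  have "(p N, p M) \<in> joined" using step by simp
  moreover have "(p M, p (Suc M)) \<in> Restr (cayley_adj G T) V" using step by simp
  ultimately show ?case by (rule rtrancl.rtrancl_into_rtrancl)
qed simp

lemma adj_pow: "g \<in> carrier G \<Longrightarrow> s \<in> S \<Longrightarrow> (g \<otimes> s [^] (i::nat), g \<otimes> s [^] Suc i) \<in> cayley_adj G T"
  using adj_mult[of "g \<otimes> s [^] i" s] S_carrier S_T by (auto simp: m_assoc subset_iff)

lemma ray_avoids:
  assumes "g \<in> carrier G" "s \<in> S"
  shows "\<exists>N::nat. \<forall>i\<ge>N. g \<otimes> s [^] i \<in> V"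
proof -
  have "inj (\<lambda>i::nat. g \<otimes> s [^] i)"
    using assms inj_pow S_carrier by (auto simp: inj_def)
  then have "finite ((\<lambda>i::nat. g \<otimes> s [^] i) -` K)"
    using finite_K by (rule finite_vimageI[rotated])
  then obtain N where N: "\<forall>i\<in>(\<lambda>i::nat. g \<otimes> s [^] i) -` K. i < N"
    unfolding finite_nat_set_iff_bounded ..
  have "\<forall>i\<ge>N. g \<otimes> s [^] i \<in> V"
    using N assms S_carrier by (metis DiffI leD m_closed nat_pow_closed vimageI)
  then show ?thesis ..
qed

lemma ray_joined:
  assumes "g \<in> carrier G" "s \<in> S" "\<And>i. i \<ge> N \<Longrightarrow> g \<otimes> s [^] i \<in> V" "N \<le> M"
  shows "(g \<otimes> s [^] (N::nat), g \<otimes> s [^] M) \<in> joined"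
  using assms by (intro joined_path[of _ _ "\<lambda>i. g \<otimes> s [^] i"] adj_pow)

lemma ends_at_indep:
  assumes g: "g \<in> carrier G" and s: "s \<in> S" and t: "t \<in> S"
    and ind: "indep_commuting G s t" and e: "ends_at g s x"
  shows "ends_at g t x"
proof -
  note c = S_carrier[OF s] S_carrier[OF t]
  let ?f = "\<lambda>(i::nat, j::nat). g \<otimes> (s [^] i \<otimes> t [^] j)"
  have "inj ?f"
    using ind g c by (auto simp: indep_commuting_def inj_def)
  then have "finite (?f -` K)"
    using finite_K by (rule finite_vimageI[rotated])
  \<comment> \<open>Injectivity puts only finitely many grid points into \<open>K\<close>;
    \<open>N1\<close> exceeds both coordinates of all of them, so one large coordinate is enough to
    avoid \<open>K\<close>.\<close>
  then have "finite (fst ` (?f -` K) \<union> snd ` (?f -` K))" by simp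
  then obtain N1 where N1: "\<forall>i\<in>fst ` (?f -` K) \<union> snd ` (?f -` K). i < N1"
    unfolding finite_nat_set_iff_bounded ..
  have avoid: "g \<otimes> (s [^] i \<otimes> t [^] j) \<in> V" if "i \<ge> N1 \<or> j \<ge> N1" for i j
  proof -
    have "(i, j) \<notin> ?f -` K"
    proof
      assume "(i, j) \<in> ?f -` K"
      then have "fst (i, j) \<in> fst ` (?f -` K)" "snd (i, j) \<in> snd ` (?f -` K)" by (blast intro: imageI)+
      then have "i < N1" "j < N1" using N1 by auto
      then show False using that by simp
    qed
    then show ?thesis using g c by auto
  qed
  obtain N2 :: nat where N2: "\<forall>i\<ge>N2. (g \<otimes> s [^] i, x) \<in> joined"
    using e unfolding ends_at_def by blast
  \<comment> \<open>The two rays are joined along a square: from \<open>g s^M\<close> in direction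
    \<open>t\<close> to the corner \<open>g s^M t^M\<close>, then back in direction \<open>s\<close>
    to \<open>g t^M\<close>. Both sides avoid \<open>K\<close> as \<open>M \<ge> N1\<close>, and the
    start is joined to \<open>x\<close> as \<open>M \<ge> N2\<close>.\<close>
  define M where "M = max N1 N2"
  have 1: "(g \<otimes> (s [^] M \<otimes> t [^] (0::nat)), g \<otimes> (s [^] M \<otimes> t [^] M)) \<in> joined"
    using g c t avoid adj_pow[of "g \<otimes> s [^] M" t]
    by (intro joined_path[of _ _ "\<lambda>j. g \<otimes> (s [^] M \<otimes> t [^] j)"]) (auto simp: M_def m_assoc)
  have 2: "(g \<otimes> (s [^] (0::nat) \<otimes> t [^] M), g \<otimes> (s [^] M \<otimes> t [^] M)) \<in> joined"
  proof (intro joined_path[of _ _ "\<lambda>i. g \<otimes> (s [^] i \<otimes> t [^] M)"])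
    fix i
    \<comment> \<open>Edges are right multiplications, so the factor \<open>s^k\<close> has to be
      moved to the right end.\<close>
    have eq: "g \<otimes> (s [^] k \<otimes> t [^] M) = g \<otimes> t [^] M \<otimes> s [^] k" for k :: nat
      using ind g c by (simp add: indep_commuting_def pow_commute m_assoc)
    show "(g \<otimes> (s [^] i \<otimes> t [^] M), g \<otimes> (s [^] Suc i \<otimes> t [^] M)) \<in> cayley_adj G T"
      unfolding eq using g c s by (intro adj_pow) auto
  qed (use avoid in \<open>auto simp: M_def\<close>)
  have "(g \<otimes> s [^] M, x) \<in> joined" using N2 by (simp add: M_def)
  then have 3: "(g \<otimes> t [^] M, x) \<in> joined"
    using rtrancl_trans[OF 2 rtrancl_trans[OF joined_sym[OF 1]], of x] g c by simp
  have v: "g \<otimes> t [^] i \<in> V" if "i \<ge> M" for i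
    using avoid[of 0 i] that g c by (simp add: M_def)
  have "g \<otimes> t [^] i \<in> V \<and> (g \<otimes> t [^] i, x) \<in> joined" if "i \<ge> M" for i
    using v[OF that] rtrancl_trans[OF joined_sym[OF ray_joined[OF g t v that]] 3] by blast
  then show ?thesis unfolding ends_at_def by blast
qed

lemma ends_at_change:
  assumes "g \<in> carrier G" "s \<in> S" "s' \<in> S" "ends_at g s x"
  shows "ends_at g s' x"
  using link[OF assms(2,3)] ends_at_indep assms by blast

text \<open>Since \<open>y s^i = s'^i y\<close>, the points \<open>g s'^i\<close> and
  \<open>g y s^i\<close> differ by right multiplication by \<open>y\<close>: the two rays run side
  by side at distance one.\<close>

lemma ends_at_shift:
  assumes g: "g \<in> carrier G" and y: "y \<in> T" and s: "s \<in> S" "s' \<in> S" and eq: "y \<otimes> s = s' \<otimes> y"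
  shows "ends_at g s' x \<longleftrightarrow> ends_at (g \<otimes> y) s x"
proof -
  have c: "y \<in> carrier G" "s \<in> carrier G" "s' \<in> carrier G"
    using y s S_carrier T_carrier by auto
  have p: "y \<otimes> s [^] i = s' [^] i \<otimes> y" for i :: nat
  proof (induction i)
    case (Suc i)
    have "y \<otimes> s [^] Suc i = s' [^] i \<otimes> (y \<otimes> s)"
      using Suc c by (simp add: m_assoc[symmetric])
    then show ?case using c eq by (simp add: m_assoc)
  qed (use c in simp)
  have q: "g \<otimes> y \<otimes> s [^] i = g \<otimes> s' [^] i \<otimes> y" for i :: nat
    using g c p[of i] by (simp add: m_assoc)
  obtain N1 :: nat where N1: "\<forall>i\<ge>N1. g \<otimes> s' [^] i \<in> V"
    using ray_avoids[OF g s(2)] ..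
  obtain N2 :: nat where N2: "\<forall>i\<ge>N2. g \<otimes> y \<otimes> s [^] i \<in> V"
    using ray_avoids[OF m_closed[OF g c(1)] s(1)] ..
  have edge: "(g \<otimes> s' [^] i, g \<otimes> y \<otimes> s [^] i) \<in> joined" if "i \<ge> max N1 N2" for i
  proof (rule r_into_rtrancl)
    have "(g \<otimes> s' [^] i, g \<otimes> s' [^] i \<otimes> y) \<in> cayley_adj G T"
      using g c y by (intro adj_mult) auto
    then show "(g \<otimes> s' [^] i, g \<otimes> y \<otimes> s [^] i) \<in> Restr (cayley_adj G T) V"
      using N1[rule_format, of i] N2[rule_format, of i] that by (simp add: q)
  qed
  show ?thesis
  proof
    assume "ends_at g s' x"
    then obtain N :: nat where N: "\<forall>i\<ge>N. (g \<otimes> s' [^] i, x) \<in> joined"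
      unfolding ends_at_def by blast
    have "g \<otimes> y \<otimes> s [^] i \<in> V \<and> (g \<otimes> y \<otimes> s [^] i, x) \<in> joined" if "i \<ge> max N (max N1 N2)" for i
      using N[rule_format, of i] N2[rule_format, of i] rtrancl_trans[OF joined_sym[OF edge[of i]], of x] that
      by simp
    then show "ends_at (g \<otimes> y) s x" unfolding ends_at_def by blast
  next
    assume "ends_at (g \<otimes> y) s x"
    then obtain N :: nat where N: "\<forall>i\<ge>N. (g \<otimes> y \<otimes> s [^] i, x) \<in> joined"
      unfolding ends_at_def by blast
    have "g \<otimes> s' [^] i \<in> V \<and> (g \<otimes> s' [^] i, x) \<in> joined" if "i \<ge> max N (max N1 N2)" for i
      using N[rule_format, of i] N1[rule_format, of i] rtrancl_trans[OF edge[of i], of x] that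
      by simp
    then show "ends_at g s' x" unfolding ends_at_def by blast
  qed
qed

text \<open>Quantifying over all directions allows a switch, on either side of the edge, to the
  direction for which \<open>conjugate\<close> supplies a partner. The equivalence covers edges
  traversed backwards.\<close>

lemma ends_at_generator:
  assumes g: "g \<in> carrier G" and y: "y \<in> T"
  shows "(\<forall>s\<in>S. ends_at g s x) \<longleftrightarrow> (\<forall>s\<in>S. ends_at (g \<otimes> y) s x)"
proof -
  obtain s s' where s: "s \<in> S" "s' \<in> S" "y \<otimes> s = s' \<otimes> y" using conjugate[OF y] by blast
  have "g \<otimes> y \<in> carrier G" using g y T_carrier by auto
  then show ?thesis using ends_at_shift[OF g y s] ends_at_change s g by metis
qed

lemma ends_at_all:
  assumes h: "h \<in> carrier G" and g: "g \<in> carrier G" and e: "\<forall>s\<in>S. ends_at g s x"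
  shows "\<forall>s\<in>S. ends_at h s x"
proof -
  have "(g, g \<otimes> (inv g \<otimes> h)) \<in> (cayley_adj G T)\<^sup>*"
    using g h by (intro connected) auto
  then have "(g, h) \<in> (cayley_adj G T)\<^sup>*" using g h by (simp add: m_assoc[symmetric])
  then show ?thesis
  proof induction
    case (step y z)
    then show ?case unfolding cayley_adj_def using ends_at_generator by blast
  qed (rule e)
qed

lemma unique_unbounded_component:
  "\<exists>!U. U \<in> cayley_components G T V \<and> \<not> cayley_bounded G T U"
proof -
  let ?E = "Restr joined V"
  have eq: "equiv V ?E"
    by (auto simp: equiv_def refl_on_def sym_def trans_def intro: joined_sym)
  obtain s0 where s0: "s0 \<in> S" using S_nonempty by blast
  then obtain t0 where t0: "t0 \<in> S" and ind: "indep_commuting G s0 t0" using link by blast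
  obtain N0 :: nat where "\<forall>i\<ge>N0. \<one> \<otimes> s0 [^] i \<in> V" using ray_avoids[OF one_closed s0] ..
  then have N0: "\<one> \<otimes> s0 [^] i \<in> V" if "i \<ge> N0" for i using that by blast
  define x0 where "x0 = \<one> \<otimes> s0 [^] N0"
  have x0V: "x0 \<in> V" using N0 by (simp add: x0_def)
  have "\<forall>i\<ge>N0. \<one> \<otimes> s0 [^] i \<in> V \<and> (\<one> \<otimes> s0 [^] i, x0) \<in> joined"
    using ray_joined[OF _ s0 N0] N0 joined_sym by (simp add: x0_def)
  then have "ends_at \<one> s0 x0" unfolding ends_at_def by blast
  then have base: "\<forall>s\<in>S. ends_at \<one> s x0" using ends_at_change s0 by blast
  have all: "ends_at g s x0" if "g \<in> carrier G" "s \<in> S" for g s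
    using ends_at_all[OF that(1) _ base] that(2) by blast
  \<comment> \<open>If the whole ray avoids \<open>K\<close>, its base point lies in the same
    component as its tail.\<close>
  have ray: "(g, x0) \<in> joined" if g: "g \<in> carrier G" and s: "s \<in> S"
    and av: "\<And>i::nat. g \<otimes> s [^] i \<in> V" for g s
  proof -
    obtain N where "(g \<otimes> s [^] (N::nat), x0) \<in> joined"
      using all[OF g s] by (auto simp: ends_at_def)
    moreover have "(g \<otimes> s [^] (0::nat), g \<otimes> s [^] N) \<in> joined"
      using ray_joined[OF g s av] by blast
    ultimately show ?thesis using g by (auto intro: rtrancl_trans)
  qed
  define D where "D = {g \<in> carrier G. \<exists>(i::nat) (j::nat). g \<otimes> s0 [^] i \<in> K \<and> g \<otimes> t0 [^] j \<in> K}"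
  note c = S_carrier[OF s0] S_carrier[OF t0]
  \<comment> \<open>A point is determined by one point of its \<open>s0\<close>-ray and one of its
    \<open>t0\<close>-ray, whatever the exponents: \<open>z = inv h g\<close> satisfies
    \<open>z s0^i = s0^i'\<close> and \<open>z t0^j = t0^j'\<close>, and computing
    \<open>z s0^i t0^j\<close> in both orders gives \<open>s0^i' t0^j = s0^i t0^j'\<close>, so
    \<open>i' = i\<close>. Hence \<open>D\<close> embeds into \<open>K \<times> K\<close>.\<close>
  have D1: "g = h" if g: "g \<in> carrier G" "h \<in> carrier G"
    and e: "g \<otimes> s0 [^] i = h \<otimes> s0 [^] i'" "g \<otimes> t0 [^] j = h \<otimes> t0 [^] j'"
    for g h and i j i' j' :: nat
  proof -
    have com: "s0 [^] a \<otimes> t0 [^] b = t0 [^] b \<otimes> s0 [^] a" for a b :: nat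
      using ind c by (simp add: indep_commuting_def pow_commute)
    have 1: "inv h \<otimes> g \<otimes> s0 [^] i = s0 [^] i'" "inv h \<otimes> g \<otimes> t0 [^] j = t0 [^] j'"
      using e g c by (metis inv_closed inv_solve_left m_assoc m_closed nat_pow_closed)+
    have "s0 [^] i' \<otimes> t0 [^] j = inv h \<otimes> g \<otimes> (s0 [^] i \<otimes> t0 [^] j)"
      using g c by (simp add: 1(1)[symmetric] m_assoc)
    also have "\<dots> = inv h \<otimes> g \<otimes> t0 [^] j \<otimes> s0 [^] i"
      using g c by (simp add: com m_assoc)
    also have "\<dots> = s0 [^] i \<otimes> t0 [^] j'"
      by (simp add: 1 com)
    finally have "i' = i"
      using ind by (auto simp: indep_commuting_def dest!: injD[of _ "(i', j)" "(i, j')"])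
    then show "g = h" using e g c by simp
  qed
  have "finite D"
  proof -
    have "\<forall>g\<in>D. \<exists>(i::nat) (j::nat). g \<otimes> s0 [^] i \<in> K \<and> g \<otimes> t0 [^] j \<in> K" unfolding D_def by blast
    then obtain i j where ij: "\<forall>g\<in>D. g \<otimes> s0 [^] (i g :: nat) \<in> K \<and> g \<otimes> t0 [^] (j g :: nat) \<in> K"
      by metis
    have "inj_on (\<lambda>g. (g \<otimes> s0 [^] i g, g \<otimes> t0 [^] j g)) D"
      using D1 by (auto simp: inj_on_def D_def)
    moreover have "(\<lambda>g. (g \<otimes> s0 [^] i g, g \<otimes> t0 [^] j g)) ` D \<subseteq> K \<times> K" using ij by auto
    ultimately show ?thesis using finite_K by (meson finite_SigmaI inj_on_finite)
  qed
  have not_D: "(g, x0) \<in> joined" if "g \<in> carrier G" "g \<notin> D" for g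
    using ray[OF that(1) s0] ray[OF that(1) t0] that c unfolding D_def by blast
  have subV: "U \<subseteq> V" if "U \<in> cayley_components G T V" for U
    using that by (auto simp: cayley_components_def quotient_def)
  have bd: "cayley_bounded G T U \<longleftrightarrow> finite U" if "U \<in> cayley_components G T V" for U
    using subV[OF that] by (intro bounded_iff_finite) auto
  have U0: "?E `` {x0} \<in> cayley_components G T V"
    unfolding cayley_components_def using x0V by (intro quotientI)
  show ?thesis
  proof (rule ex1I[of _ "?E `` {x0}"], intro conjI)
    have "inj (\<lambda>i::nat. s0 [^] (N0 + i))"
    proof (rule injI)
      fix i j :: nat
      assume "s0 [^] (N0 + i) = s0 [^] (N0 + j)"
      then have "N0 + i = N0 + j" by (rule injD[OF inj_pow[OF s0]])
      then show "i = j" by simp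
    qed
    then have "infinite (range (\<lambda>i::nat. s0 [^] (N0 + i)))" by (rule range_inj_infinite)
    moreover have "range (\<lambda>i::nat. s0 [^] (N0 + i)) \<subseteq> ?E `` {x0}"
    proof (rule image_subsetI)
      fix i :: nat
      have "(x0, \<one> \<otimes> s0 [^] (N0 + i)) \<in> joined"
        unfolding x0_def using s0 N0 by (intro ray_joined) auto
      then show "s0 [^] (N0 + i) \<in> ?E `` {x0}" using N0[of "N0 + i"] x0V c by simp
    qed
    ultimately show "\<not> cayley_bounded G T (?E `` {x0})"
      using bd[OF U0] finite_subset by blast
  next
    fix U assume U: "U \<in> cayley_components G T V \<and> \<not> cayley_bounded G T U"
    then obtain x where x: "x \<in> V" "U = ?E `` {x}"
      by (auto simp: cayley_components_def elim!: quotientE)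
    have "infinite U" using U bd by blast
    then have "\<not> U \<subseteq> D" using \<open>finite D\<close> finite_subset by blast
    then obtain g where g: "g \<in> U" "g \<notin> D" by blast
    then have "(g, x0) \<in> joined" "(x, g) \<in> joined" using not_D x by auto
    then have "(x, x0) \<in> ?E" using x x0V by (auto intro: rtrancl_trans)
    then show "U = ?E `` {x0}" using equiv_class_eq[OF eq] x by blast
  qed (rule U0)
qed

end

theorem one_ended: "one_ended G"
  unfolding one_ended_def
  using is_group infinite_carrier finite_T T_carrier generate_T
    unique_unbounded_component[OF finite_ball] by blast

end

text \<open>The invariant \<open>\<phi>\<close> is constant on the fibres of \<open>h\<close>, so
  equal products of powers in \<open>H\<close> have preimages with equal invariants; injectivity
  seen by \<open>\<phi>\<close> in \<open>G\<close> thus becomes independence in \<open>H\<close>.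
  \<open>R\<close> is a relation from which this can be read off.\<close>

lemma (in group_hom) one_ended_surj:
  assumes surj: "h ` carrier G = carrier H"
    and T: "finite T" "T \<subseteq> carrier G" "generate G T = carrier G"
    and S: "S \<subseteq> T" "S \<noteq> {}"
    and inv: "\<And>a b. a \<in> carrier G \<Longrightarrow> b \<in> carrier G \<Longrightarrow> h a = h b \<Longrightarrow> \<phi> a = \<phi> b"
    and link: "\<And>s s'. s \<in> S \<Longrightarrow> s' \<in> S \<Longrightarrow> \<exists>u\<in>S. R s u \<and> R u s'"
    and R: "\<And>s t. s \<in> S \<Longrightarrow> t \<in> S \<Longrightarrow> R s t \<Longrightarrow> s \<otimes>\<^bsub>G\<^esub> t = t \<otimes>\<^bsub>G\<^esub> s \<and>
       inj (\<lambda>(i::nat, j::nat). \<phi> (s [^]\<^bsub>G\<^esub> i \<otimes>\<^bsub>G\<^esub> t [^]\<^bsub>G\<^esub> j))"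
    and conj: "\<And>y. y \<in> T \<Longrightarrow> \<exists>s\<in>S. \<exists>s'\<in>S. y \<otimes>\<^bsub>G\<^esub> s = s' \<otimes>\<^bsub>G\<^esub> y"
  shows "one_ended H"
proof -
  have ind: "indep_commuting H (h s) (h t)" if st: "s \<in> S" "t \<in> S" "R s t" for s t
  proof -
    have c: "s \<in> carrier G" "t \<in> carrier G" using st S T by auto
    have *: "\<phi> (s [^]\<^bsub>G\<^esub> i \<otimes>\<^bsub>G\<^esub> t [^]\<^bsub>G\<^esub> j) = \<phi> (s [^]\<^bsub>G\<^esub> i' \<otimes>\<^bsub>G\<^esub> t [^]\<^bsub>G\<^esub> j')"
      if "h s [^]\<^bsub>H\<^esub> i \<otimes>\<^bsub>H\<^esub> h t [^]\<^bsub>H\<^esub> j = h s [^]\<^bsub>H\<^esub> i' \<otimes>\<^bsub>H\<^esub> h t [^]\<^bsub>H\<^esub> j'" for i j i' j' :: nat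
      using that c by (intro inv) (auto simp: hom_nat_pow[symmetric])
    have "h s \<otimes>\<^bsub>H\<^esub> h t = h t \<otimes>\<^bsub>H\<^esub> h s"
      using R[OF st] c by (metis hom_mult)
    moreover have "inj (\<lambda>(i::nat, j::nat). h s [^]\<^bsub>H\<^esub> i \<otimes>\<^bsub>H\<^esub> h t [^]\<^bsub>H\<^esub> j)"
    proof (rule injI, clarify)
      fix i j i' j' :: nat
      assume "h s [^]\<^bsub>H\<^esub> i \<otimes>\<^bsub>H\<^esub> h t [^]\<^bsub>H\<^esub> j = h s [^]\<^bsub>H\<^esub> i' \<otimes>\<^bsub>H\<^esub> h t [^]\<^bsub>H\<^esub> j'"
      then show "i = i' \<and> j = j'"
        using *[of i j i' j'] injD[OF conjunct2[OF R[OF st]], of "(i, j)" "(i', j')"] by simp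
    qed
    ultimately show ?thesis by (simp add: indep_commuting_def)
  qed
  interpret L: linked_generators H "h ` T" "h ` S"
  proof
    show "generate H (h ` T) = carrier H" using generate_img[OF T(2)] T(3) surj by simp
    show "\<exists>u\<in>h ` S. indep_commuting H s u \<and> indep_commuting H u s'"
      if s: "s \<in> h ` S" and s': "s' \<in> h ` S" for s s'
    proof -
      obtain a b where ab: "a \<in> S" "b \<in> S" "s = h a" "s' = h b" using s s' by blast
      obtain u where "u \<in> S" "R a u" "R u b" using link[OF ab(1,2)] by blast
      then show ?thesis using ind ab by blast
    qed
    show "\<exists>s\<in>h ` S. \<exists>s'\<in>h ` S. y \<otimes>\<^bsub>H\<^esub> s = s' \<otimes>\<^bsub>H\<^esub> y" if y: "y \<in> h ` T" for y
    proof -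
      obtain z where z: "z \<in> T" "y = h z" using y by blast
      then obtain s s' where s: "s \<in> S" "s' \<in> S" "z \<otimes>\<^bsub>G\<^esub> s = s' \<otimes>\<^bsub>G\<^esub> z" using conj by blast
      then have "h z \<otimes>\<^bsub>H\<^esub> h s = h s' \<otimes>\<^bsub>H\<^esub> h z" using z S T by (metis hom_mult subset_iff)
      then show ?thesis using s z by blast
    qed
  qed (use T S in auto)
  show ?thesis by (rule L.one_ended)
qed

section \<open>Endomorphisms of free groups\<close>

declare split_paired_All [simp del] split_paired_Ex [simp del]

abbreviation letters :: "nat \<Rightarrow> letter set" where
  "letters n \<equiv> {..<n} \<times> UNIV"

lemma inv_letter_simps [simp]:
  "fst (inv_letter a) = fst a" "snd (inv_letter a) \<longleftrightarrow> \<not> snd a"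
  "inv_letter a \<noteq> a" "a \<noteq> inv_letter a" "inv_letter a = inv_letter b \<longleftrightarrow> a = b"
  by (auto simp: inv_letter_def prod_eq_iff)

lemma inv_letter_eq_iff: "inv_letter a = b \<longleftrightarrow> a = inv_letter b"
  by auto

lemma same_generator: "fst a = fst b \<Longrightarrow> a = b \<or> a = inv_letter b"
  by (auto simp: inv_letter_def prod_eq_iff)

definition winv :: "word \<Rightarrow> word" where
  "winv w = rev (map inv_letter w)"

lemma winv_simps [simp]:
  "winv [] = []" "winv [a] = [inv_letter a]" "winv [a, b] = [inv_letter b, inv_letter a]"
  "winv (winv w) = w" "length (winv w) = length w" "winv (u @ v) = winv v @ winv u"
  "winv (a # v) = winv v @ [inv_letter a]" "winv w = [] \<longleftrightarrow> w = []"
  by (auto simp: winv_def rev_map o_def)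

lemma carrier_free_group:
  "w \<in> carrier (free_group n) \<longleftrightarrow> w \<in> lists (letters n) \<and> reduced w"
  by (simp add: free_group_def)

lemma one_free_group [simp]: "\<one>\<^bsub>free_group n\<^esub> = []"
  by (simp add: free_group_def)

lemma Nil_carrier [simp]: "[] \<in> carrier (free_group n)"
  by (simp add: carrier_free_group)

lemma letter_carrier [simp]: "[a] \<in> carrier (free_group n) \<longleftrightarrow> fst a < n"
  by (auto simp: carrier_free_group reduced_Cons mem_Times_iff)

lemma pair_carrier: "[a, b] \<in> carrier (free_group n) \<longleftrightarrow> fst a < n \<and> fst b < n \<and> b \<noteq> inv_letter a"
  by (auto simp: carrier_free_group reduced_Cons mem_Times_iff)

lemma mult_letter: "[a] \<otimes>\<^bsub>free_group n\<^esub> w = letter_mult a w"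
  by (simp add: free_group_def)

lemma Cons_carrierD:
  assumes "a # w \<in> carrier (free_group n)"
  shows "fst a < n" "w \<in> carrier (free_group n)" "a # w = [a] \<otimes>\<^bsub>free_group n\<^esub> w"
    "w = [] \<or> hd w \<noteq> inv_letter a"
  using assms by (cases w; auto simp: carrier_free_group reduced_Cons mem_Times_iff mult_letter)+

lemma inv_free_group:
  assumes "w \<in> carrier (free_group n)"
  shows "inv\<^bsub>free_group n\<^esub> w = winv w"
proof -
  interpret F: group "free_group n" by (rule group_free_group)
  have "winv w \<in> carrier (free_group n)"
    using assms by (fastforce simp: carrier_free_group winv_def reduced_inverse inv_letter_def)
  moreover have "winv w \<otimes>\<^bsub>free_group n\<^esub> w = []"
    using assms foldr_inverse[of "[]" w] by (simp add: free_group_def winv_def foldr_letter_mult_Nil)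
  ultimately show ?thesis using assms by (intro F.inv_equality) auto
qed

lemma winv_carrier [simp]: "w \<in> carrier (free_group n) \<Longrightarrow> winv w \<in> carrier (free_group n)"
  using inv_free_group group.inv_closed[OF group_free_group] by metis

lemma hom_letters_eq:
  assumes "f \<in> hom (free_group n) G" "g \<in> hom (free_group n) G" "group G"
    and eq: "\<And>i. i < n \<Longrightarrow> f [(i, True)] = g [(i, True)]" and w: "w \<in> carrier (free_group n)"
  shows "f w = g w"
proof -
  interpret f: group_hom "free_group n" G f
    using assms by (simp add: group_hom_def group_hom_axioms_def group_free_group)
  interpret g: group_hom "free_group n" G g
    using assms by (simp add: group_hom_def group_hom_axioms_def group_free_group)
  have letter: "f [a] = g [a]" if "fst a < n" for a
  proof (cases "snd a")
    case True
    then show ?thesis using eq[OF that] by (metis prod.collapse)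
  next
    case False
    then have "[a] = inv\<^bsub>free_group n\<^esub> [(fst a, True)]"
      using that by (subst inv_free_group) (auto simp: inv_letter_def prod_eq_iff)
    moreover have "[(fst a, True)] \<in> carrier (free_group n)" using that by simp
    ultimately show ?thesis using eq[OF that] by (metis f.hom_inv g.hom_inv)
  qed
  show ?thesis using w
  proof (induction w)
    case Nil
    then show ?case using f.hom_one g.hom_one by simp
  next
    case (Cons a w)
    note d = Cons_carrierD[OF Cons.prems]
    have "f (a # w) = f [a] \<otimes>\<^bsub>G\<^esub> f w" "g (a # w) = g [a] \<otimes>\<^bsub>G\<^esub> g w"
      using d by (metis f.hom_mult letter_carrier, metis g.hom_mult letter_carrier)
    then show ?case using letter[OF d(1)] Cons.IH[OF d(2)] by simp
  qed
qed

text \<open>Images are prescribed on inverse letters too, so that evaluation is a plain fold;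
  compatibility with inversion becomes a hypothesis of \<open>free_hom_hom\<close>. Restriction to
  the carrier makes the map extensional, as \<open>Bij\<close> demands.\<close>

definition free_hom :: "nat \<Rightarrow> (letter \<Rightarrow> word) \<Rightarrow> word \<Rightarrow> word" where
  "free_hom n W = (\<lambda>w\<in>carrier (free_group n). foldr (\<lambda>a v. W a \<otimes>\<^bsub>free_group n\<^esub> v) w [])"

lemma free_hom_letter:
  assumes "fst a < n" "W a \<in> carrier (free_group n)"
  shows "free_hom n W [a] = W a"
proof -
  interpret F: group "free_group n" by (rule group_free_group)
  show ?thesis using assms F.r_one[of "W a"] by (simp add: free_hom_def)
qed

lemma free_hom_hom:
  assumes W: "\<And>a. fst a < n \<Longrightarrow> W a \<in> carrier (free_group n)"
    and W_inv: "\<And>a. fst a < n \<Longrightarrow> W (inv_letter a) = winv (W a)"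
  shows "free_hom n W \<in> hom (free_group n) (free_group n)"
proof -
  interpret F: group "free_group n" by (rule group_free_group)
  define E where "E w = foldr (\<lambda>a v. W a \<otimes>\<^bsub>free_group n\<^esub> v) w []" for w
  have E: "E w \<in> carrier (free_group n)" if "w \<in> lists (letters n)" for w
    using that by (induction w) (auto simp: E_def W mem_Times_iff)
  have EC: "E (a # w) = W a \<otimes>\<^bsub>free_group n\<^esub> E w" for a w by (simp add: E_def)
  \<comment> \<open>The only place where words cancel: compatibility of \<open>W\<close> with
    inversion matches the cancellation made by \<open>letter_mult\<close>.\<close>
  have letter: "E (letter_mult a w) = W a \<otimes>\<^bsub>free_group n\<^esub> E w"
    if a: "fst a < n" and w: "w \<in> lists (letters n)" for a w
  proof (cases w)
    case (Cons b v)
    show ?thesis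
    proof (cases "b = inv_letter a")
      case True
      have v: "E v \<in> carrier (free_group n)" using w Cons E by auto
      have "W b = inv\<^bsub>free_group n\<^esub> W a" using True W_inv W a by (simp add: inv_free_group)
      then have "W a \<otimes>\<^bsub>free_group n\<^esub> (W b \<otimes>\<^bsub>free_group n\<^esub> E v) = E v"
        using W[OF a] v by (simp add: F.m_assoc[symmetric] del: one_free_group)
      then show ?thesis using Cons True by (simp add: EC)
    qed (simp add: Cons EC)
  qed (simp add: EC)
  have mult: "E (foldr letter_mult u v) = E u \<otimes>\<^bsub>free_group n\<^esub> E v"
    if u: "u \<in> lists (letters n)" and v: "v \<in> lists (letters n)" for u v
    using u
  proof (induction u)
    case Nil
    then show ?case using E[OF v] F.l_one by (simp add: E_def)
  next
    case (Cons a u)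
    then have a: "fst a < n" and u: "u \<in> lists (letters n)" by auto
    have "foldr letter_mult u v \<in> lists (letters n)"
      by (rule foldr_letter_mult_in_lists[OF u v])
    then show ?case using letter[OF a] Cons.IH E[OF u] E[OF v] W[OF a]
      by (simp add: EC F.m_assoc)
  qed
  show ?thesis
  proof (rule homI)
    fix x y assume x: "x \<in> carrier (free_group n)" and y: "y \<in> carrier (free_group n)"
    have "foldr letter_mult x y \<in> carrier (free_group n)"
      using F.m_closed[OF x y] by (simp add: free_group_def)
    then show "free_hom n W (x \<otimes>\<^bsub>free_group n\<^esub> y) = free_hom n W x \<otimes>\<^bsub>free_group n\<^esub> free_hom n W y"
      using mult[of x y] x y
      by (simp add: free_hom_def E_def[symmetric] carrier_free_group) (simp add: free_group_def)
  qed (use E in \<open>auto simp: free_hom_def E_def[symmetric] carrier_free_group\<close>)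
qed

section \<open>The automorphism group of the free group\<close>

lemma carrier_AutF: "carrier (AutF n) = hom (free_group n) (free_group n) \<inter> Bij (carrier (free_group n))"
  by (simp add: AutF_def AutoGroup_def auto_def)

lemma mult_AutF:
  "f \<in> carrier (AutF n) \<Longrightarrow> g \<in> carrier (AutF n) \<Longrightarrow>
    f \<otimes>\<^bsub>AutF n\<^esub> g = compose (carrier (free_group n)) f g"
  by (simp add: carrier_AutF) (simp add: AutF_def AutoGroup_def BijGroup_def)

lemma one_AutF: "\<one>\<^bsub>AutF n\<^esub> = (\<lambda>x\<in>carrier (free_group n). x)"
  by (simp add: AutF_def AutoGroup_def BijGroup_def)

lemma group_AutF: "group (AutF n)"
  unfolding AutF_def by (rule group.AutoGroup[OF group_free_group])

lemma AutF_hom: "f \<in> carrier (AutF n) \<Longrightarrow> f \<in> hom (free_group n) (free_group n)"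
  by (simp add: carrier_AutF)

lemma AutF_closed: "f \<in> carrier (AutF n) \<Longrightarrow> w \<in> carrier (free_group n) \<Longrightarrow> f w \<in> carrier (free_group n)"
  using AutF_hom by (auto simp: hom_def)

lemma AutF_mult:
  "f \<in> carrier (AutF n) \<Longrightarrow> u \<in> carrier (free_group n) \<Longrightarrow> v \<in> carrier (free_group n) \<Longrightarrow>
    f (u \<otimes>\<^bsub>free_group n\<^esub> v) = f u \<otimes>\<^bsub>free_group n\<^esub> f v"
  by (rule hom_mult[OF AutF_hom])

lemma AutF_winv:
  assumes "f \<in> carrier (AutF n)" "u \<in> carrier (free_group n)"
  shows "f (winv u) = winv (f u)"
proof -
  interpret group_hom "free_group n" "free_group n" f
    using assms AutF_hom by (simp add: group_hom_def group_hom_axioms_def group_free_group)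
  show ?thesis using hom_inv[of u] assms AutF_closed by (simp add: inv_free_group)
qed

lemma AutF_Nil: "f \<in> carrier (AutF n) \<Longrightarrow> f [] = []"
  using hom_one[OF AutF_hom group_free_group group_free_group] by simp

lemma AutF_inj: "f \<in> carrier (AutF n) \<Longrightarrow> inj_on f (carrier (free_group n))"
  by (simp add: carrier_AutF Bij_def bij_betw_def)

lemma AutF_surj: "f \<in> carrier (AutF n) \<Longrightarrow> f ` carrier (free_group n) = carrier (free_group n)"
  by (simp add: carrier_AutF Bij_def bij_betw_def)

lemma AutF_eqI:
  assumes "f \<in> carrier (AutF n)" "g \<in> carrier (AutF n)"
    "\<And>i. i < n \<Longrightarrow> f [(i, True)] = g [(i, True)]"
  shows "f = g"
proof (rule extensionalityI[of _ "carrier (free_group n)"])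
  show "f w = g w" if "w \<in> carrier (free_group n)" for w
    using hom_letters_eq[OF _ _ group_free_group _ that] assms AutF_hom by metis
qed (use assms in \<open>auto simp: carrier_AutF Bij_def\<close>)

lemma AutF_apply:
  "f \<in> carrier (AutF n) \<Longrightarrow> g \<in> carrier (AutF n) \<Longrightarrow> w \<in> carrier (free_group n) \<Longrightarrow>
    (f \<otimes>\<^bsub>AutF n\<^esub> g) w = f (g w)"
  by (simp add: mult_AutF compose_eq)

text \<open>Both composites are endomorphisms that agree with the identity on generators, hence
  everywhere on the carrier; bijectivity becomes a computation on letters.\<close>

lemma AutF_memI:
  assumes f: "f \<in> hom (free_group n) (free_group n)" and ext: "f \<in> extensional (carrier (free_group n))"
    and g: "g \<in> hom (free_group n) (free_group n)"
    and fg: "\<And>i. i < n \<Longrightarrow> f (g [(i, True)]) = [(i, True)]"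
    and gf: "\<And>i. i < n \<Longrightarrow> g (f [(i, True)]) = [(i, True)]"
  shows "f \<in> carrier (AutF n)"
proof -
  have id: "(\<lambda>x. x) \<in> hom (free_group n) (free_group n)" by (simp add: hom_def)
  have comp: "(\<lambda>w. f (g w)) \<in> hom (free_group n) (free_group n)"
    "(\<lambda>w. g (f w)) \<in> hom (free_group n) (free_group n)"
    using f g by (auto simp: hom_def Pi_iff)
  have 1: "f (g w) = w" if "w \<in> carrier (free_group n)" for w
    using hom_letters_eq[OF comp(1) id group_free_group _ that] fg by simp
  have 2: "g (f w) = w" if "w \<in> carrier (free_group n)" for w
    using hom_letters_eq[OF comp(2) id group_free_group _ that] gf by simp
  have "bij_betw f (carrier (free_group n)) (carrier (free_group n))"
    by (rule bij_betw_byWitness[where f'=g]) (use 1 2 f g in \<open>auto simp: hom_def\<close>)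
  then show ?thesis using f ext by (simp add: carrier_AutF Bij_def)
qed

section \<open>Transvections\<close>

text \<open>As \<open>d\<close> may be an inverse letter, \<open>d \<mapsto> l d\<close> covers the transvections
  \<open>x\<^sub>i \<mapsto> l x\<^sub>i\<close> as well as \<open>x\<^sub>i \<mapsto> x\<^sub>i l\<close>.\<close>

definition transvection :: "nat \<Rightarrow> letter \<Rightarrow> letter \<Rightarrow> word \<Rightarrow> word" where
  "transvection n d l = free_hom n (\<lambda>a. if a = d then [l, d] else
     if a = inv_letter d then [inv_letter d, inv_letter l] else [a])"

context
  fixes n :: nat and d l :: letter
  assumes d: "fst d < n" and l: "fst l < n" and ne: "fst d \<noteq> fst l"
begin

lemma transvection_hom: "transvection n d l \<in> hom (free_group n) (free_group n)"
  unfolding transvection_def using d l ne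
  by (intro free_hom_hom) (auto simp: pair_carrier inv_letter_eq_iff)

lemma transvection_letter:
  assumes "fst a < n"
  shows "transvection n d l [a] = (if a = d then [l, d] else
     if a = inv_letter d then [inv_letter d, inv_letter l] else [a])"
  unfolding transvection_def using d l ne assms
  by (subst free_hom_letter) (auto simp: pair_carrier inv_letter_eq_iff)

end

lemma transvection_pair:
  assumes "fst d < n" "fst l < n" "fst d \<noteq> fst l" "fst a < n" "fst b < n" "b \<noteq> inv_letter a"
  shows "transvection n d l [a, b] = transvection n d l [a] \<otimes>\<^bsub>free_group n\<^esub> transvection n d l [b]"
proof -
  have "[a, b] = [a] \<otimes>\<^bsub>free_group n\<^esub> [b]" using assms by (simp add: mult_letter)
  then show ?thesis using hom_mult[OF transvection_hom] assms by (metis letter_carrier)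
qed

lemma transvection_cancel:
  assumes "fst d < n" "fst l < n" "fst d \<noteq> fst l" "fst a < n"
  shows "transvection n d l (transvection n d (inv_letter l) [a]) = [a]"
proof -
  have ne: "l \<noteq> d" "d \<noteq> l" "inv_letter d \<noteq> l" "inv_letter l \<noteq> d" "d \<noteq> inv_letter l" "l \<noteq> inv_letter d"
    using assms by auto
  show ?thesis
    using assms ne by (cases "a = d"; cases "a = inv_letter d")
      (simp_all add: transvection_letter transvection_pair free_group_def)
qed

lemma transvection_AutF:
  assumes "fst d < n" "fst l < n" "fst d \<noteq> fst l"
  shows "transvection n d l \<in> carrier (AutF n)"
proof (rule AutF_memI[where g = "transvection n d (inv_letter l)"])
  show "transvection n d (inv_letter l) (transvection n d l [(i, True)]) = [(i, True)]" if "i < n" for i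
    using transvection_cancel[of d n "inv_letter l" "(i, True)"] that assms by simp
qed (use assms transvection_cancel in \<open>auto simp: transvection_hom, simp add: transvection_def free_hom_def\<close>)

definition transvections :: "nat \<Rightarrow> (word \<Rightarrow> word) set" where
  "transvections n = {transvection n d l | d l. fst d < n \<and> fst l < n \<and> fst d \<noteq> fst l}"

lemma transvectionsI:
  "fst d < n \<Longrightarrow> fst l < n \<Longrightarrow> fst d \<noteq> fst l \<Longrightarrow> transvection n d l \<in> transvections n"
  by (auto simp: transvections_def)

lemma transvections_AutF: "transvections n \<subseteq> carrier (AutF n)"
  by (auto simp: transvections_def transvection_AutF)

lemma finite_transvections: "finite (transvections n)"
proof -
  have "transvections n \<subseteq> (\<lambda>(d, l). transvection n d l) ` (letters n \<times> letters n)"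
    by (force simp: transvections_def mem_Times_iff)
  then show ?thesis by (rule finite_subset) simp
qed

text \<open>Each map fixes both letters that define the other. The multipliers \<open>l\<close> and
  \<open>l'\<close> may share an index, which keeps down the number of generators that a link
  requires.\<close>

lemma transvection_commute:
  assumes "fst d < n" "fst l < n" "fst d' < n" "fst l' < n" "fst d \<noteq> fst l" "fst d' \<noteq> fst l'"
    "fst d \<noteq> fst d'" "fst d \<noteq> fst l'" "fst d' \<noteq> fst l"
  shows "transvection n d l \<otimes>\<^bsub>AutF n\<^esub> transvection n d' l' =
    transvection n d' l' \<otimes>\<^bsub>AutF n\<^esub> transvection n d l"
proof (rule AutF_eqI)
  fix i assume i: "i < n"
  have ne: "d \<noteq> d'" "d' \<noteq> d" "inv_letter d \<noteq> d'" "inv_letter d' \<noteq> d" "d \<noteq> inv_letter d'" "d' \<noteq> inv_letter d"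
    "l \<noteq> d'" "l' \<noteq> d" "inv_letter l \<noteq> d'" "inv_letter l' \<noteq> d" "l \<noteq> d" "l' \<noteq> d'"
    "l \<noteq> inv_letter d'" "l' \<noteq> inv_letter d" "l \<noteq> inv_letter d" "l' \<noteq> inv_letter d'" "d \<noteq> inv_letter l" "d' \<noteq> inv_letter l'"
    using assms by auto
  have c: "transvection n d l \<in> carrier (AutF n)" "transvection n d' l' \<in> carrier (AutF n)"
    using assms by (simp_all add: transvection_AutF)
  show "(transvection n d l \<otimes>\<^bsub>AutF n\<^esub> transvection n d' l') [(i, True)] =
      (transvection n d' l' \<otimes>\<^bsub>AutF n\<^esub> transvection n d l) [(i, True)]"
    using assms ne i c
    by (simp add: AutF_apply transvection_letter transvection_pair mult_letter)
next
  interpret A: group "AutF n" by (rule group_AutF)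
  show "transvection n d l \<otimes>\<^bsub>AutF n\<^esub> transvection n d' l' \<in> carrier (AutF n)"
    "transvection n d' l' \<otimes>\<^bsub>AutF n\<^esub> transvection n d l \<in> carrier (AutF n)"
    using assms transvection_AutF by (auto intro!: A.m_closed simp del: split_paired_All)
qed

section \<open>Action on the abelianisation\<close>

abbreviation letter_sign :: "letter \<Rightarrow> int" where
  "letter_sign a \<equiv> if snd a then 1 else - 1"

lemma exponent_sum_simps [simp]:
  "exponent_sum i [] = 0"
  "exponent_sum i (a # w) = (if fst a = i then letter_sign a else 0) + exponent_sum i w"
  by (simp_all add: exponent_sum_def)

lemma abelianised_mat_carrier [simp]: "abelianised_mat n f \<in> carrier_mat n n"
  by (auto simp: abelianised_mat_def intro!: carrier_matI)

lemma abelianised_mat_dim [simp]: "dim_row (abelianised_mat n f) = n" "dim_col (abelianised_mat n f) = n"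
  by (simp_all add: abelianised_mat_def)

lemma abelianised_mat_index [simp]:
  "r < n \<Longrightarrow> c < n \<Longrightarrow> abelianised_mat n f $$ (r, c) = exponent_sum r (f [(c, True)])"
  by (simp add: abelianised_mat_def mat_of_cols_index abelianise_def)

lemma abelianised_mat_mult:
  assumes "f \<in> carrier (AutF n)" "g \<in> carrier (AutF n)"
  shows "abelianised_mat n (f \<otimes>\<^bsub>AutF n\<^esub> g) = abelianised_mat n f * abelianised_mat n g"
proof (rule eq_matI)
  fix r c assume "r < dim_row (abelianised_mat n f * abelianised_mat n g)"
    "c < dim_col (abelianised_mat n f * abelianised_mat n g)"
  then have rc: "r < n" "c < n" by auto
  have "exponent_sum r (f (g [(c, True)])) =
      (\<Sum>j<n. exponent_sum r (f [(j, True)]) * exponent_sum j (g [(c, True)]))"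
    using rc by (intro exponent_sum_hom[OF AutF_hom[OF assms(1)] AutF_closed[OF assms(2)]]) simp
  then show "abelianised_mat n (f \<otimes>\<^bsub>AutF n\<^esub> g) $$ (r, c) = (abelianised_mat n f * abelianised_mat n g) $$ (r, c)"
    using rc assms by (simp add: AutF_apply scalar_prod_def lessThan_atLeast0)
qed auto

lemma abelianised_mat_one: "abelianised_mat n \<one>\<^bsub>AutF n\<^esub> = 1\<^sub>m n"
  by (rule eq_matI) (auto simp: one_AutF)

text \<open>Right composition acts on columns. If \<open>d\<close> is an inverse letter, the
  generator itself goes to \<open>x l^-1\<close>, which accounts for the product of the two
  signs.\<close>

lemma abelianised_mat_mult_transvection:
  assumes f: "f \<in> carrier (AutF n)" and d: "fst d < n" "fst l < n" "fst d \<noteq> fst l"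
  shows "abelianised_mat n (f \<otimes>\<^bsub>AutF n\<^esub> transvection n d l) =
    mat_addcol (letter_sign d * letter_sign l) (fst d) (fst l) (abelianised_mat n f)"
proof -
  have e: "exponent_sum r (f [a]) = letter_sign a * exponent_sum r (f [(fst a, True)])" if "fst a < n" for a r
    using exponent_sum_hom_letter[OF AutF_hom[OF f] that, of r "snd a"] by simp
  have p: "exponent_sum r (f [a, b]) = exponent_sum r (f [a]) + exponent_sum r (f [b])"
    if "fst a < n" "fst b < n" "fst a \<noteq> fst b" for a b r
  proof -
    have "[a, b] = [a] \<otimes>\<^bsub>free_group n\<^esub> [b]" using that by (auto simp: mult_letter)
    then have "f [a, b] = f [a] \<otimes>\<^bsub>free_group n\<^esub> f [b]"
      using f that by (metis AutF_mult letter_carrier)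
    then show ?thesis by (simp add: exponent_sum_mult)
  qed
  have t: "transvection n d l [(c, True)] = (if c = fst d then
      if snd d then [l, (c, True)] else [(c, True), inv_letter l] else [(c, True)])" if "c < n" for c
    using d that by (auto simp: transvection_letter prod_eq_iff)
  show ?thesis
  proof (rule eq_matI)
    fix r c assume "r < dim_row (mat_addcol (letter_sign d * letter_sign l) (fst d) (fst l) (abelianised_mat n f))"
      "c < dim_col (mat_addcol (letter_sign d * letter_sign l) (fst d) (fst l) (abelianised_mat n f))"
    then have rc: "r < n" "c < n" by auto
    show "abelianised_mat n (f \<otimes>\<^bsub>AutF n\<^esub> transvection n d l) $$ (r, c) =
      mat_addcol (letter_sign d * letter_sign l) (fst d) (fst l) (abelianised_mat n f) $$ (r, c)"
      using rc d f e[of l r] e[of "inv_letter l" r] p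
      by (auto simp: AutF_apply transvection_AutF t)
  qed auto
qed

text \<open>Column \<open>fst l\<close>, which is being added, never changes because
  \<open>fst d \<noteq> fst l\<close>; so the multiples accumulate linearly in
  \<open>k\<close>.\<close>

lemma abelianised_mat_mult_transvection_pow:
  assumes f: "f \<in> carrier (AutF n)" and d: "fst d < n" "fst l < n" "fst d \<noteq> fst l"
    and rc: "r < n" "c < n"
  shows "abelianised_mat n (f \<otimes>\<^bsub>AutF n\<^esub> (transvection n d l [^]\<^bsub>AutF n\<^esub> (k::nat))) $$ (r, c) =
    abelianised_mat n f $$ (r, c) +
    (if c = fst d then int k * (letter_sign d * letter_sign l) * abelianised_mat n f $$ (r, fst l) else 0)"
  using rc(2)
proof (induction k arbitrary: c)
  case 0
  interpret A: group "AutF n" by (rule group_AutF)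
  show ?case using f by simp
next
  case (Suc k)
  interpret A: group "AutF n" by (rule group_AutF)
  note t = transvection_AutF[OF d]
  let ?t = "transvection n d l"
  have "f \<otimes>\<^bsub>AutF n\<^esub> (?t [^]\<^bsub>AutF n\<^esub> Suc k) = f \<otimes>\<^bsub>AutF n\<^esub> (?t [^]\<^bsub>AutF n\<^esub> k) \<otimes>\<^bsub>AutF n\<^esub> ?t"
    using f t by (simp add: A.m_assoc)
  moreover have "f \<otimes>\<^bsub>AutF n\<^esub> (?t [^]\<^bsub>AutF n\<^esub> k) \<in> carrier (AutF n)" using f t by simp
  ultimately have "abelianised_mat n (f \<otimes>\<^bsub>AutF n\<^esub> (?t [^]\<^bsub>AutF n\<^esub> Suc k)) =
     mat_addcol (letter_sign d * letter_sign l) (fst d) (fst l) (abelianised_mat n (f \<otimes>\<^bsub>AutF n\<^esub> (?t [^]\<^bsub>AutF n\<^esub> k)))"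
    using abelianised_mat_mult_transvection d by metis
  then show ?case using Suc.IH Suc.prems d rc(1)
    by (auto simp: algebra_simps simp del: abelianised_mat_index)
qed

text \<open>Up to sign, \<open>i\<close> is the entry in row \<open>fst l\<close> and column
  \<open>fst d\<close>, and \<open>j\<close> the entry in row \<open>fst l'\<close> and column
  \<open>fst d'\<close>.\<close>

lemma transvection_indep:
  assumes "fst d < n" "fst l < n" "fst d' < n" "fst l' < n" "fst d \<noteq> fst l" "fst d' \<noteq> fst l'"
    "fst d \<noteq> fst d'" "fst d \<noteq> fst l'" "fst d' \<noteq> fst l"
  shows "inj (\<lambda>(i::nat, j::nat). abelianised_mat n
    (transvection n d l [^]\<^bsub>AutF n\<^esub> i \<otimes>\<^bsub>AutF n\<^esub> transvection n d' l' [^]\<^bsub>AutF n\<^esub> j))"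
proof (rule injI, clarify)
  interpret A: group "AutF n" by (rule group_AutF)
  let ?s = "transvection n d l" and ?t = "transvection n d' l'"
  have c: "?s \<in> carrier (AutF n)" "?t \<in> carrier (AutF n)" using assms transvection_AutF by auto
  have s: "abelianised_mat n (?s [^]\<^bsub>AutF n\<^esub> i) $$ (r, k) =
      (if r = k then 1 else 0) + (if k = fst d \<and> r = fst l then int i * (letter_sign d * letter_sign l) else 0)"
    if "r < n" "k < n" for r k and i :: nat
    using abelianised_mat_mult_transvection_pow[of "\<one>\<^bsub>AutF n\<^esub>" n d l r k i] that assms c
    by (simp add: abelianised_mat_one del: abelianised_mat_index)
  have st: "abelianised_mat n (?s [^]\<^bsub>AutF n\<^esub> i \<otimes>\<^bsub>AutF n\<^esub> ?t [^]\<^bsub>AutF n\<^esub> j) $$ (r, k) =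
      abelianised_mat n (?s [^]\<^bsub>AutF n\<^esub> i) $$ (r, k) + (if k = fst d' then
        int j * (letter_sign d' * letter_sign l') * abelianised_mat n (?s [^]\<^bsub>AutF n\<^esub> i) $$ (r, fst l') else 0)"
    if "r < n" "k < n" for r k and i j :: nat
    using that assms c by (intro abelianised_mat_mult_transvection_pow) auto
  fix i j i' j' :: nat
  assume "abelianised_mat n (?s [^]\<^bsub>AutF n\<^esub> i \<otimes>\<^bsub>AutF n\<^esub> ?t [^]\<^bsub>AutF n\<^esub> j) =
    abelianised_mat n (?s [^]\<^bsub>AutF n\<^esub> i' \<otimes>\<^bsub>AutF n\<^esub> ?t [^]\<^bsub>AutF n\<^esub> j')"
  then have eq: "abelianised_mat n (?s [^]\<^bsub>AutF n\<^esub> i \<otimes>\<^bsub>AutF n\<^esub> ?t [^]\<^bsub>AutF n\<^esub> j) $$ (r, k) =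
    abelianised_mat n (?s [^]\<^bsub>AutF n\<^esub> i' \<otimes>\<^bsub>AutF n\<^esub> ?t [^]\<^bsub>AutF n\<^esub> j') $$ (r, k)" for r k
    by simp
  show "i = i' \<and> j = j'"
    using eq[of "fst l" "fst d"] eq[of "fst l'" "fst d'"] assms
    by (auto simp: st s simp del: abelianised_mat_index split: if_splits)
qed

section \<open>Cancellation in free groups\<close>

fun lcp :: "'a list \<Rightarrow> 'a list \<Rightarrow> nat" where
  "lcp (x # xs) (y # ys) = (if x = y then Suc (lcp xs ys) else 0)"
| "lcp _ _ = 0"

lemma lcp_sym: "lcp u v = lcp v u"
  by (induction u v rule: lcp.induct) auto

lemma le_lcp_iff: "k \<le> lcp u v \<longleftrightarrow> k \<le> length u \<and> k \<le> length v \<and> take k u = take k v"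
proof (induction u v arbitrary: k rule: lcp.induct)
  case (1 x xs y ys)
  then show ?case by (cases k) auto
qed auto

lemma lcp_le: "lcp u v \<le> length u" "lcp u v \<le> length v" "take (lcp u v) u = take (lcp u v) v"
  using le_lcp_iff[of "lcp u v" u v] by auto

text \<open>If \<open>v\<close> and \<open>w\<close> still agree where \<open>u\<close> leaves
  \<open>v\<close>, then \<open>u\<close> leaves \<open>w\<close> at the same place.\<close>

lemma lcp_ultrametric:
  assumes "lcp u v < lcp v w"
  shows "lcp u w = lcp u v"
proof -
  have "k \<le> lcp u w \<longleftrightarrow> k \<le> lcp u v" if "k \<le> lcp v w" for k
    using that by (auto simp: le_lcp_iff)
  moreover from this[of "Suc (lcp u v)"] have "lcp u w \<le> lcp u v" using assms by simp
  ultimately show ?thesis using assms by (metis le_antisym less_imp_le order_refl)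
qed

lemma reduced_append:
  "reduced (u @ v) \<longleftrightarrow> reduced u \<and> reduced v \<and> (u \<noteq> [] \<longrightarrow> v \<noteq> [] \<longrightarrow> hd v \<noteq> inv_letter (last u))"
  by (auto simp: reduced_def successively_append_iff)

lemma foldr_letter_mult_reduced: "reduced (u @ v) \<Longrightarrow> foldr letter_mult u v = u @ v"
proof (induction u)
  case (Cons a u)
  then show ?case by (cases "u @ v") (auto simp: reduced_Cons)
qed simp

text \<open>What cancels in a product \<open>u v\<close> of reduced words is exactly the common
  prefix of \<open>u^-1\<close> and \<open>v\<close>; from here on cancellation is measured by
  \<open>lcp\<close>.\<close>

lemma foldr_letter_mult_lcp:
  assumes "reduced u" "reduced v"
  shows "foldr letter_mult u v = take (length u - lcp (winv u) v) u @ drop (lcp (winv u) v) v"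
  using assms
proof (induction u arbitrary: v rule: rev_induct)
  case (snoc a u)
  show ?case
  proof (cases "v \<noteq> [] \<and> hd v = inv_letter a")
    case True
    then obtain v' where v: "v = inv_letter a # v'" by (cases v) auto
    have "foldr letter_mult u v' = take (length u - lcp (winv u) v') u @ drop (lcp (winv u) v') v'"
      using snoc.prems v by (intro snoc.IH) (auto simp: reduced_append reduced_Cons)
    then show ?thesis by (simp add: v)
  next
    case False
    then have "lcp (winv (u @ [a])) v = 0" by (cases v) auto
    moreover have "reduced ((u @ [a]) @ v)"
      using snoc.prems False by (subst reduced_append) auto
    ultimately show ?thesis using foldr_letter_mult_reduced[of "u @ [a]" v] by simp
  qed
qed simp

lemma free_group_mult_lcp:
  assumes "u \<in> carrier (free_group n)" "v \<in> carrier (free_group n)"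
  shows "u \<otimes>\<^bsub>free_group n\<^esub> v = take (length u - lcp (winv u) v) u @ drop (lcp (winv u) v) v"
proof -
  have "reduced u" "reduced v" using assms by (simp_all add: carrier_free_group)
  then show ?thesis using foldr_letter_mult_lcp by (simp add: free_group_def)
qed

lemma length_free_group_mult:
  assumes "u \<in> carrier (free_group n)" "v \<in> carrier (free_group n)"
  shows "length (u \<otimes>\<^bsub>free_group n\<^esub> v) + 2 * lcp (winv u) v = length u + length v"
  using lcp_le[of "winv u" v] assms by (simp add: free_group_mult_lcp)

text \<open>If the common prefix reached the middle, then in even length the two middle letters
  would be mutually inverse, against reducedness, and in odd length the middle letter would be its
  own inverse.\<close>

lemma lcp_winv_self:
  assumes "reduced u" "u \<noteq> []"
  shows "2 * lcp u (winv u) < length u"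
proof (rule ccontr)
  assume "\<not> 2 * lcp u (winv u) < length u"
  then have c: "length u \<le> 2 * lcp u (winv u)" by simp
  have nth: "u ! k = inv_letter (u ! (length u - 1 - k))" if "k < lcp u (winv u)" for k
  proof -
    have "k < length u" using that lcp_le[of u "winv u"] by linarith
    have "u ! k = winv u ! k"
      using arg_cong[OF lcp_le(3)[of u "winv u"], of "\<lambda>x. x ! k"] that by simp
    also have "\<dots> = inv_letter (u ! (length u - 1 - k))"
      using \<open>k < length u\<close> by (simp add: winv_def rev_nth)
    finally show ?thesis .
  qed
  show False
  proof (cases "even (length u)")
    case True
    then obtain m where m: "length u = 2 * Suc m" using assms by (metis dvdE length_0_conv mult_0_right not0_implies_Suc)
    then have "u ! m = inv_letter (u ! Suc m)" using nth[of m] c by simp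
    moreover have "u ! Suc m \<noteq> inv_letter (u ! m)"
      using assms(1) m unfolding reduced_def successively_conv_nth by simp
    ultimately show False by simp
  next
    case False
    then obtain m where m: "length u = 2 * m + 1" by (metis oddE)
    then have "u ! m = inv_letter (u ! m)" using nth[of m] c by simp
    then show False by simp
  qed
qed

section \<open>Nielsen reduction\<close>

definition letter_code :: "letter \<Rightarrow> nat" where
  "letter_code a = 2 * fst a + (if snd a then 1 else 0)"

text \<open>A numeral in base \<open>2 * n\<close>: on words of equal length over
  \<open>letters n\<close> it is the lexicographic order, in a form usable as a measure.\<close>

definition word_code :: "nat \<Rightarrow> word \<Rightarrow> nat" where
  "word_code n w = foldl (\<lambda>c a. c * (2 * n) + letter_code a) 0 w"

lemma letter_code_less: "fst a < n \<Longrightarrow> letter_code a < 2 * n"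
  by (auto simp: letter_code_def)

lemma letter_code_inj: "letter_code a = letter_code b \<Longrightarrow> a = b"
  by (auto simp: letter_code_def prod_eq_iff split: if_splits) presburger+

lemma word_code_snoc: "word_code n (w @ [a]) = word_code n w * (2 * n) + letter_code a"
  by (simp add: word_code_def)

lemma word_code_inj:
  assumes "length u = length v" "u \<in> lists (letters n)" "v \<in> lists (letters n)"
    "word_code n u = word_code n v"
  shows "u = v"
  using assms
proof (induction u arbitrary: v rule: rev_induct)
  case (snoc a u)
  then obtain b v' where v: "v = v' @ [b]" by (metis append_Nil2 length_0_conv rev_exhaust snoc_eq_iff_butlast)
  have ab: "letter_code a < 2 * n" "letter_code b < 2 * n"
    using snoc.prems v by (auto intro!: letter_code_less)
  have eq: "word_code n u * (2 * n) + letter_code a = word_code n v' * (2 * n) + letter_code b"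
    using snoc.prems v by (simp add: word_code_snoc)
  from arg_cong[OF eq, of "\<lambda>x. x mod (2 * n)"] have "letter_code a = letter_code b"
    using ab by (simp add: mult.commute)
  moreover from arg_cong[OF eq, of "\<lambda>x. x div (2 * n)"] have "word_code n u = word_code n v'"
    using ab by (simp add: mult.commute)
  ultimately show ?case using snoc.IH[of v'] snoc.prems v letter_code_inj by simp
qed simp

lemma word_code_append_less:
  assumes "length p = length q" "word_code n q < word_code n p" "n > 0"
  shows "word_code n (q @ x) < word_code n (p @ x)"
proof (induction x rule: rev_induct)
  case (snoc a x)
  then have "Suc (word_code n (q @ x)) * (2 * n) \<le> word_code n (p @ x) * (2 * n)"
    by (intro mult_right_mono) auto
  then show ?case using snoc assms(3) word_code_snoc[of n "q @ x" a] word_code_snoc[of n "p @ x" a]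
    by simp
qed (use assms in simp)

definition half :: "'a list \<Rightarrow> 'a list" where
  "half w = take ((length w + 1) div 2) w"

definition total_length :: "nat \<Rightarrow> (word \<Rightarrow> word) \<Rightarrow> nat" where
  "total_length n f = (\<Sum>a\<in>letters n. length (f [a]))"

text \<open>Letters of both signs contribute, so the code sees the initial half of each image and
  also, through its inverse, the final half.\<close>

definition total_code :: "nat \<Rightarrow> (word \<Rightarrow> word) \<Rightarrow> nat" where
  "total_code n f = (\<Sum>a\<in>letters n. word_code n (half (f [a])))"

text \<open>Composing on the right with a transvection is a Nielsen move on the images of the
  letters: it touches only the image of \<open>d\<close> and its inverse.\<close>

lemma AutF_transvection_letter:
  assumes f: "f \<in> carrier (AutF n)" and d: "fst d < n" "fst l < n" "fst d \<noteq> fst l" and a: "fst a < n"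
  shows "(f \<otimes>\<^bsub>AutF n\<^esub> transvection n d l) [a] =
    (if a = d then f [l] \<otimes>\<^bsub>free_group n\<^esub> f [d]
     else if a = inv_letter d then winv (f [l] \<otimes>\<^bsub>free_group n\<^esub> f [d]) else f [a])"
proof -
  have ld: "[l, d] = [l] \<otimes>\<^bsub>free_group n\<^esub> [d]" using d by (auto simp: mult_letter)
  then have *: "f [l, d] = f [l] \<otimes>\<^bsub>free_group n\<^esub> f [d]" using f d by (simp add: AutF_mult)
  have "[l, d] \<in> carrier (free_group n)" using d by (auto simp: pair_carrier)
  then have "f [inv_letter d, inv_letter l] = winv (f [l, d])" using AutF_winv[OF f] by fastforce
  then show ?thesis using * f d a by (simp add: AutF_apply transvection_AutF transvection_letter)
qed

text \<open>Minimality is local, against one move at a time; \<open>measures\<close> compares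
  lexicographically, with length first.\<close>

definition nielsen_minimal :: "nat \<Rightarrow> (word \<Rightarrow> word) \<Rightarrow> bool" where
  "nielsen_minimal n f \<longleftrightarrow> (\<forall>t\<in>transvections n.
     (f \<otimes>\<^bsub>AutF n\<^esub> t, f) \<notin> measures [total_length n, total_code n])"

locale nielsen_minimal_aut =
  fixes n :: nat and f :: "word \<Rightarrow> word"
  assumes f: "f \<in> carrier (AutF n)" and minimal: "nielsen_minimal n f"
begin

section \<open>Cancellation between the images of letters under a minimal automorphism\<close>

abbreviation W :: "letter \<Rightarrow> word" where "W a \<equiv> f [a]"

lemma W_carrier: "fst a < n \<Longrightarrow> W a \<in> carrier (free_group n)"
  using AutF_closed[OF f] by simp

lemma W_reduced: "fst a < n \<Longrightarrow> reduced (W a)"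
  using W_carrier by (simp add: carrier_free_group)

lemma W_inv: "fst a < n \<Longrightarrow> W (inv_letter a) = winv (W a)"
  using AutF_winv[OF f, of "[a]"] by simp

lemma W_nonempty: "fst a < n \<Longrightarrow> W a \<noteq> []"
  using inj_onD[OF AutF_inj[OF f], of "[a]" "[]"] AutF_Nil[OF f] by auto

lemma not_shorter:
  assumes "fst d < n" "fst l < n" "fst d \<noteq> fst l"
  shows "length (W d) \<le> length (W l \<otimes>\<^bsub>free_group n\<^esub> W d)"
proof (rule ccontr)
  assume "\<not> ?thesis"
  then have less: "length (W l \<otimes>\<^bsub>free_group n\<^esub> W d) < length (W d)" by simp
  let ?g = "f \<otimes>\<^bsub>AutF n\<^esub> transvection n d l"
  have "total_length n ?g < total_length n f"
    unfolding total_length_def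
  proof (rule sum_strict_mono_ex1)
    show "\<forall>a\<in>letters n. length (?g [a]) \<le> length (W a)"
      using less assms by (auto simp: AutF_transvection_letter[OF f] W_inv simp del: split_paired_All)
    show "\<exists>a\<in>letters n. length (?g [a]) < length (W a)"
      using less assms by (intro bexI[of _ d]) (auto simp: AutF_transvection_letter[OF f] mem_Times_iff)
  qed simp
  then show False using minimal transvectionsI[OF assms] by (auto simp: nielsen_minimal_def)
qed

text \<open>If more than half of \<open>W b\<close> cancelled, \<open>W b^-1 W a\<close> would be
  shorter than \<open>W a\<close>. When \<open>a\<close> is the inverse of \<open>b\<close> there is
  no such move, and \<open>lcp_winv_self\<close> takes over.\<close>

lemma cancel_half:
  assumes "fst a < n" "fst b < n" "a \<noteq> b"
  shows "2 * lcp (W a) (W b) \<le> length (W b)"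
proof (cases "fst a = fst b")
  case True
  then have "a = inv_letter b" using assms same_generator by blast
  then show ?thesis
    using lcp_winv_self[OF W_reduced W_nonempty, of b] assms by (simp add: W_inv lcp_sym)
next
  case False
  have "length (W a) \<le> length (W (inv_letter b) \<otimes>\<^bsub>free_group n\<^esub> W a)"
    using assms False by (intro not_shorter) auto
  moreover have "length (W (inv_letter b) \<otimes>\<^bsub>free_group n\<^esub> W a) + 2 * lcp (W b) (W a) =
      length (W b) + length (W a)"
    using length_free_group_mult[OF W_carrier W_carrier, of "inv_letter b" a] assms by (simp add: W_inv)
  ultimately show ?thesis by (simp add: lcp_sym)
qed

text \<open>The tie-break: if exactly half of \<open>W b = p q\<^sup>-\<^sup>1\<close> cancels, then replacing the initial
  segment \<open>p\<close> of \<open>W a\<close> by \<open>q\<close> keeps all lengths, so by minimality it cannot lower the code.\<close>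

lemma code_le:
  assumes a: "fst a < n" and b: "fst b < n" "a \<noteq> b"
    and h: "length (W b) = 2 * h" "lcp (W a) (W b) = h"
  shows "word_code n (take h (W b)) \<le> word_code n (take h (winv (W b)))"
proof (rule ccontr)
  define p q r where "p = take h (W b)" and "q = take h (winv (W b))" and "r = drop h (W a)"
  assume "\<not> ?thesis"
  then have less: "word_code n q < word_code n p" by (simp add: p_def q_def)
  have ab: "fst a \<noteq> fst b"
  proof
    assume "fst a = fst b"
    then have "a = inv_letter b" using b same_generator by blast
    then show False using lcp_winv_self[OF W_reduced W_nonempty, of b] b h by (simp add: W_inv lcp_sym)
  qed
  have half_a: "2 * h \<le> length (W a)" using cancel_half[of b a] a b h(2) by (simp add: lcp_sym)
  have lens: "length p = h" "length q = h" "length r = length (W a) - h"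
    using h(1) half_a by (simp_all add: p_def q_def r_def)
  have Wa: "W a = p @ r"
    using lcp_le(3)[of "W a" "W b"] h(2) append_take_drop_id[of h "W a"] by (simp add: p_def r_def)
  have ga: "W (inv_letter b) \<otimes>\<^bsub>free_group n\<^esub> W a = q @ r"
    using free_group_mult_lcp[OF W_carrier W_carrier, of "inv_letter b" a] a b h
    by (simp add: W_inv lcp_sym[of "W b"] q_def r_def)
  let ?g = "f \<otimes>\<^bsub>AutF n\<^esub> transvection n a (inv_letter b)"
  have g: "?g [c] = (if c = a then q @ r else if c = inv_letter a then winv r @ winv q else W c)"
    if "fst c < n" for c
    using AutF_transvection_letter[OF f, of a "inv_letter b" c] that a b ab by (simp add: ga)
  have Wia: "W (inv_letter a) = winv r @ winv p" using W_inv[OF a] by (simp add: Wa)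
  have "total_length n ?g = total_length n f"
    unfolding total_length_def
    using g Wa Wia lens by (intro sum.cong) auto
  moreover have "total_code n ?g < total_code n f"
    unfolding total_code_def
  proof (rule sum_strict_mono_ex1)
    \<comment> \<open>As \<open>h \<le> length r\<close>, the changed prefix lies inside the initial
      half of \<open>W a\<close>, whereas the initial half of its inverse lies inside
      \<open>winv r\<close> and does not change. So exactly one summand of the code drops.\<close>
    have le: "(h + length r + 1) div 2 \<le> length r" "h \<le> (h + length r + 1) div 2"
      using lens half_a by linarith+
    have 1: "word_code n (half (q @ r)) < word_code n (half (p @ r))"
      using word_code_append_less[OF _ less] lens le a by (simp add: half_def)
    have 2: "half (winv r @ winv q) = half (winv r @ winv p)"
      using lens le by (simp add: half_def add.commute)
    show "\<forall>c\<in>letters n. word_code n (half (?g [c])) \<le> word_code n (half (W c))"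
      using g 1 2 Wa Wia by auto
    show "\<exists>c\<in>letters n. word_code n (half (?g [c])) < word_code n (half (W c))"
      using g 1 Wa a by (intro bexI[of _ a]) (auto simp: mem_Times_iff)
  qed simp
  moreover have "transvection n a (inv_letter b) \<in> transvections n"
    using a b ab by (intro transvectionsI) auto
  ultimately show False using minimal by (auto simp: nielsen_minimal_def)
qed

text \<open>If nothing of \<open>W b\<close> survived between its neighbours, each side would absorb
  exactly half of \<open>W b = p q^-1\<close>. Then \<open>code_le\<close> for \<open>b\<close> and
  for its inverse bounds the codes of \<open>p\<close> and \<open>q\<close> by each other, so
  \<open>p = q\<close>, and \<open>p p^-1\<close> is not a nonempty reduced word.\<close>

lemma cancel_both:
  assumes a: "fst a < n" "a \<noteq> b" and b: "fst b < n" and e: "fst e < n" "e \<noteq> inv_letter b"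
  shows "lcp (W a) (W b) + lcp (W (inv_letter b)) (W e) < length (W b)"
proof (rule ccontr)
  assume "\<not> ?thesis"
  moreover have "2 * lcp (W a) (W b) \<le> length (W b)" using cancel_half a b by blast
  moreover have "2 * lcp (W e) (W (inv_letter b)) \<le> length (W b)"
    using cancel_half[of e "inv_letter b"] b e by (simp add: W_inv)
  moreover define h where "h = lcp (W a) (W b)"
  ultimately have h: "length (W b) = 2 * h" "lcp (W a) (W b) = h" "lcp (W e) (W (inv_letter b)) = h"
    using lcp_sym[of "W e" "W (inv_letter b)"] by linarith+
  have "word_code n (take h (W b)) \<le> word_code n (take h (winv (W b)))"
    using code_le[of a b h] a b h by blast
  moreover have "word_code n (take h (winv (W b))) \<le> word_code n (take h (W b))"
    using code_le[of e "inv_letter b" h] b e h by (simp add: W_inv)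
  moreover have "set (take h (W b)) \<subseteq> letters n" "set (take h (winv (W b))) \<subseteq> letters n"
    using W_carrier[OF b] winv_carrier[OF W_carrier[OF b]] set_take_subset
    by (fastforce simp: carrier_free_group)+
  ultimately have "take h (W b) = take h (winv (W b))"
    using h(1) by (intro word_code_inj[of _ _ n]) auto
  then have "h \<le> lcp (W b) (winv (W b))" using h(1) by (simp add: le_lcp_iff)
  then show False using lcp_winv_self[OF W_reduced[OF b] W_nonempty[OF b]] h(1) by simp
qed

lemma image_Cons:
  assumes "a # w \<in> carrier (free_group n)"
  shows "f (a # w) = take (length (W a) - lcp (W (inv_letter a)) (f w)) (W a) @
      drop (lcp (W (inv_letter a)) (f w)) (f w)"
    "length (f (a # w)) + 2 * lcp (W (inv_letter a)) (f w) = length (W a) + length (f w)"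
proof -
  note d = Cons_carrierD[OF assms]
  have "f (a # w) = W a \<otimes>\<^bsub>free_group n\<^esub> f w"
    using d AutF_mult[OF f] by (metis letter_carrier)
  then show "f (a # w) = take (length (W a) - lcp (W (inv_letter a)) (f w)) (W a) @
      drop (lcp (W (inv_letter a)) (f w)) (f w)"
    "length (f (a # w)) + 2 * lcp (W (inv_letter a)) (f w) = length (W a) + length (f w)"
    using free_group_mult_lcp[OF W_carrier[OF d(1)] AutF_closed[OF f d(2)]]
      length_free_group_mult[OF W_carrier[OF d(1)] AutF_closed[OF f d(2)]] d(1)
    by (simp_all add: W_inv)
qed

text \<open>By \<open>image_Cons\<close>, the inequality says that at least \<open>length w\<close>
  letters of \<open>f w\<close> survive the cancellation against \<open>W a\<close>. Every inner
  image keeps a nonempty core by \<open>cancel_both\<close>, so cancellation never reaches past the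
  image of the next letter, and each core contributes at least one letter.\<close>

lemma nielsen_reduced:
  assumes "a # w \<in> carrier (free_group n)"
  shows "lcp (W (inv_letter a)) (f w) = (if w = [] then 0 else lcp (W (inv_letter a)) (W (hd w))) \<and>
    length (W a) + length w \<le> length (f (a # w)) + lcp (W (inv_letter a)) (f w)"
  using assms
proof (induction w arbitrary: a)
  case Nil
  then show ?case using AutF_Nil[OF f] by simp
next
  case (Cons b w)
  note d = Cons_carrierD(1,2)[OF Cons.prems] and d' = Cons_carrierD(1,2)[OF Cons_carrierD(2)[OF Cons.prems]]
  have ba: "b \<noteq> inv_letter a" using Cons_carrierD(4)[OF Cons.prems] by simp
  let ?k = "lcp (W (inv_letter b)) (f w)"
  have IH: "?k = (if w = [] then 0 else lcp (W (inv_letter b)) (W (hd w)))"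
    "length (W b) + length w \<le> length (f (b # w)) + ?k"
    using Cons.IH[OF d(2)] by blast+
  have "lcp (W (inv_letter a)) (W b) + ?k < length (W b)"
  proof (cases w)
    case Nil
    have "2 * lcp (W (inv_letter a)) (W b) \<le> length (W b)" using d d' ba by (intro cancel_half) auto
    moreover have "length (W b) > 0" using W_nonempty[OF d'(1)] by simp
    moreover have "?k = 0" using IH(1) Nil by simp
    ultimately show ?thesis by linarith
  next
    case (Cons e w')
    then have "fst e < n" "e \<noteq> inv_letter b"
      using Cons_carrierD(1)[of e w'] Cons_carrierD(4)[OF d(2)] d'(2) by auto
    then show ?thesis using cancel_both[of "inv_letter a" b e] d d' ba IH(1) Cons by auto
  qed
  \<comment> \<open>The first \<open>length (W b) - ?k\<close> letters of \<open>W b\<close> are a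
    prefix of \<open>f (b # w)\<close>, and \<open>W (inv_letter a)\<close> departs from
    \<open>W b\<close> before they end; so it departs from \<open>f (b # w)\<close> at the same
    place.\<close>
  moreover have "length (W b) - ?k \<le> lcp (W b) (f (b # w))"
    using image_Cons[OF d(2)] lcp_le(1,2)[of "W (inv_letter b)" "f w"] d'(1)
    by (simp add: le_lcp_iff W_inv)
  ultimately have 1: "lcp (W (inv_letter a)) (f (b # w)) = lcp (W (inv_letter a)) (W b)"
    by (intro lcp_ultrametric) simp
  then show ?case
    using IH(2) image_Cons(2)[OF Cons.prems] \<open>lcp (W (inv_letter a)) (W b) + ?k < length (W b)\<close>
    by simp
qed

text \<open>Less than the whole of \<open>W a\<close> cancels, so the first letter adds at least one
  to the bound of \<open>nielsen_reduced\<close>. As a minimal automorphism shortens no word, the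
  preimage of a letter can only be a letter.\<close>

lemma length_le:
  assumes "w \<in> carrier (free_group n)"
  shows "length w \<le> length (f w)"
proof (cases w)
  case (Cons a v)
  have c: "a # v \<in> carrier (free_group n)" using assms Cons by simp
  note d = Cons_carrierD[OF c]
  have "2 * lcp (W (inv_letter a)) (f v) \<le> length (W a)"
  proof (cases v)
    case Nil
    then show ?thesis using AutF_Nil[OF f] by simp
  next
    case (Cons b u)
    then have "b \<noteq> inv_letter a" "fst b < n"
      using Cons_carrierD(1)[of b u] Cons_carrierD(4)[OF c] d(2) by auto
    then have "2 * lcp (W b) (W (inv_letter a)) \<le> length (W (inv_letter a))"
      using d by (intro cancel_half) auto
    then show ?thesis using nielsen_reduced[OF c] Cons d(1) by (simp add: W_inv lcp_sym)
  qed
  moreover have "length (W a) > 0" using W_nonempty[OF d(1)] by simp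
  ultimately have "lcp (W (inv_letter a)) (f v) < length (W a)" by linarith
  then show ?thesis using nielsen_reduced[OF c] Cons by simp
qed simp

lemma letter_preimage:
  assumes x: "fst x < n"
  shows "\<exists>a. fst a < n \<and> W a = [x]"
proof -
  obtain w where w: "w \<in> carrier (free_group n)" "f w = [x]"
    using AutF_surj[OF f] x by (metis imageE letter_carrier)
  have "length w \<le> 1" using length_le[OF w(1)] w(2) by simp
  moreover have "w \<noteq> []" using w(2) AutF_Nil[OF f] by auto
  ultimately obtain a where "w = [a]" by (cases w) auto
  then show ?thesis using w by auto
qed

end

definition permutes_letters :: "nat \<Rightarrow> (word \<Rightarrow> word) \<Rightarrow> bool" where
  "permutes_letters n f \<longleftrightarrow> (\<forall>x. fst x < n \<longrightarrow> (\<exists>a. fst a < n \<and> f [a] = [x]))"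

lemma permutes_lettersD: "permutes_letters n f \<Longrightarrow> fst x < n \<Longrightarrow> \<exists>a. fst a < n \<and> f [a] = [x]"
  by (simp add: permutes_letters_def)

lemma (in nielsen_minimal_aut) permutes_letters: "permutes_letters n f"
  using letter_preimage by (auto simp: permutes_letters_def)

abbreviation elementary :: "nat \<Rightarrow> (word \<Rightarrow> word) set" where
  "elementary n \<equiv> generate (AutF n) (transvections n)"

lemma elementary_AutF: "h \<in> elementary n \<Longrightarrow> h \<in> carrier (AutF n)"
  using group.generate_in_carrier[OF group_AutF transvections_AutF] .

lemma elementary_mult:
  "h \<in> elementary n \<Longrightarrow> k \<in> elementary n \<Longrightarrow> h \<otimes>\<^bsub>AutF n\<^esub> k \<in> elementary n"
  by (rule generate.eng)

text \<open>As long as some transvection lowers the measure it is applied; well-foundedness ends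
  this at a minimal automorphism.\<close>

lemma nielsen_reduction:
  "f \<in> carrier (AutF n) \<Longrightarrow> \<exists>h\<in>elementary n. permutes_letters n (f \<otimes>\<^bsub>AutF n\<^esub> h)"
proof (induction f rule: wf_induct[OF wf_measures[of "[total_length n, total_code n]"]])
  case (1 f)
  interpret A: group "AutF n" by (rule group_AutF)
  show ?case
  proof (cases "nielsen_minimal n f")
    case True
    then interpret nielsen_minimal_aut n f using 1 by unfold_locales
    have "f \<otimes>\<^bsub>AutF n\<^esub> \<one>\<^bsub>AutF n\<^esub> = f" using f by simp
    then show ?thesis using permutes_letters generate.one by metis
  next
    case False
    then obtain t where t: "t \<in> transvections n"
      "(f \<otimes>\<^bsub>AutF n\<^esub> t, f) \<in> measures [total_length n, total_code n]"
      unfolding nielsen_minimal_def by blast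
    have tA: "t \<in> carrier (AutF n)" using t(1) transvections_AutF by blast
    then obtain h where h: "h \<in> elementary n" "permutes_letters n (f \<otimes>\<^bsub>AutF n\<^esub> t \<otimes>\<^bsub>AutF n\<^esub> h)"
      using 1 t(2) by (metis A.m_closed)
    moreover have "t \<otimes>\<^bsub>AutF n\<^esub> h \<in> elementary n"
      by (rule elementary_mult[OF generate.incl[OF t(1)] h(1)])
    ultimately show ?thesis using 1 tA elementary_AutF by (metis A.m_assoc)
  qed
qed

section \<open>Signed permutations\<close>

lemma transvection_elementary:
  "fst d < n \<Longrightarrow> fst l < n \<Longrightarrow> fst d \<noteq> fst l \<Longrightarrow> transvection n d l \<in> elementary n"
  by (intro generate.incl transvectionsI)

text \<open>A quarter turn is a product of three shears, here lifted as
  \<open>x \<mapsto> x y\<close>, \<open>y \<mapsto> y x^-1\<close>, \<open>x \<mapsto> y x\<close>.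
  One sign has to change because transvections have determinant 1.\<close>

lemma swap_letters:
  assumes "fst x < n" "fst y < n" "fst x \<noteq> fst y"
  shows "\<exists>h\<in>elementary n. h [x] = [y] \<and> h [y] = [inv_letter x] \<and>
    (\<forall>c. fst c < n \<longrightarrow> fst c \<noteq> fst x \<longrightarrow> fst c \<noteq> fst y \<longrightarrow> h [c] = [c])"
proof -
  interpret A: group "AutF n" by (rule group_AutF)
  let ?s = "transvection n (inv_letter x) (inv_letter y)" and ?t = "transvection n (inv_letter y) x"
    and ?u = "transvection n x y"
  have el: "?s \<in> elementary n" "?t \<in> elementary n" "?u \<in> elementary n"
    using assms by (auto intro!: transvection_elementary)
  note c = el[THEN elementary_AutF]
  have ne: "x \<noteq> y" "y \<noteq> x" "inv_letter x \<noteq> y" "inv_letter y \<noteq> x" "x \<noteq> inv_letter y" "y \<noteq> inv_letter x"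
    using assms by auto
  have app: "(?s \<otimes>\<^bsub>AutF n\<^esub> ?t \<otimes>\<^bsub>AutF n\<^esub> ?u) [a] = ?s (?t (?u [a]))" if "fst a < n" for a
    using c that by (simp add: AutF_apply AutF_closed)
  have "(?s \<otimes>\<^bsub>AutF n\<^esub> ?t \<otimes>\<^bsub>AutF n\<^esub> ?u) [x] = [y]"
    "(?s \<otimes>\<^bsub>AutF n\<^esub> ?t \<otimes>\<^bsub>AutF n\<^esub> ?u) [y] = [inv_letter x]"
    using assms ne by (simp_all add: app transvection_letter transvection_pair mult_letter free_group_def)
  moreover have "(?s \<otimes>\<^bsub>AutF n\<^esub> ?t \<otimes>\<^bsub>AutF n\<^esub> ?u) [c] = [c]"
    if "fst c < n" "fst c \<noteq> fst x" "fst c \<noteq> fst y" for c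
    using that assms by (auto simp: app transvection_letter)
  moreover have "?s \<otimes>\<^bsub>AutF n\<^esub> ?t \<otimes>\<^bsub>AutF n\<^esub> ?u \<in> elementary n"
    using el by (intro elementary_mult)
  ultimately show ?thesis by blast
qed

lemma permutes_letters_mult:
  assumes "f \<in> carrier (AutF n)" "h \<in> carrier (AutF n)" "permutes_letters n f" "permutes_letters n h"
  shows "permutes_letters n (f \<otimes>\<^bsub>AutF n\<^esub> h)"
  unfolding permutes_letters_def
proof (intro allI impI)
  fix x :: letter assume "fst x < n"
  then obtain a where a: "fst a < n" "f [a] = [x]" using assms(3) by (auto simp: permutes_letters_def)
  then obtain b where b: "fst b < n" "h [b] = [a]" using assms(4) by (auto simp: permutes_letters_def)
  then show "\<exists>a. fst a < n \<and> (f \<otimes>\<^bsub>AutF n\<^esub> h) [a] = [x]"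
    using a assms(1,2) by (auto simp: AutF_apply intro!: exI[of _ b])
qed

lemma swap_permutes_letters:
  assumes h: "h \<in> carrier (AutF n)" and xy: "fst x < n" "fst y < n"
    and hxy: "h [x] = [y]" "h [y] = [inv_letter x]"
    and fixed: "\<forall>c. fst c < n \<longrightarrow> fst c \<noteq> fst x \<longrightarrow> fst c \<noteq> fst y \<longrightarrow> h [c] = [c]"
  shows "permutes_letters n h"
  unfolding permutes_letters_def
proof (intro allI impI)
  fix c :: letter assume c: "fst c < n"
  have inv: "h [inv_letter x] = [inv_letter y]" "h [inv_letter y] = [x]"
    using AutF_winv[OF h, of "[x]"] AutF_winv[OF h, of "[y]"] hxy xy by auto
  consider "fst c \<noteq> fst x" "fst c \<noteq> fst y" | "c = x" | "c = inv_letter x" | "c = y" | "c = inv_letter y"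
    using same_generator by blast
  then show "\<exists>a. fst a < n \<and> h [a] = [c]"
    by cases (use fixed c xy hxy inv in \<open>metis inv_letter_simps(1)\<close>)+
qed

text \<open>Generators are put right one after the other. With \<open>k < n\<close> there is always
  a later generator left that can take over a wrong sign; only the sign of the last one remains
  beyond reach.\<close>

lemma sort_letters:
  assumes "k < n" "f \<in> carrier (AutF n)" "permutes_letters n f"
  shows "\<exists>h\<in>elementary n. permutes_letters n (f \<otimes>\<^bsub>AutF n\<^esub> h) \<and>
    (\<forall>i<k. (f \<otimes>\<^bsub>AutF n\<^esub> h) [(i, True)] = [(i, True)])"
  using assms(1)
proof (induction k)
  case 0
  interpret A: group "AutF n" by (rule group_AutF)
  have "f \<otimes>\<^bsub>AutF n\<^esub> \<one>\<^bsub>AutF n\<^esub> = f" using assms by simp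
  then show ?case using assms generate.one by (metis not_less_zero)
next
  case (Suc k)
  interpret A: group "AutF n" by (rule group_AutF)
  let ?k = "(k, True)"
  define good where "good g \<longleftrightarrow> g \<in> carrier (AutF n) \<and> permutes_letters n g \<and>
    (\<forall>i<k. g [(i, True)] = [(i, True)])" for g
  have move: "\<exists>h\<in>elementary n. good (g \<otimes>\<^bsub>AutF n\<^esub> h) \<and> (g \<otimes>\<^bsub>AutF n\<^esub> h) [?k] = g [a] \<and>
      (g \<otimes>\<^bsub>AutF n\<^esub> h) [a] = g [inv_letter ?k]"
    if g: "good g" and a: "k < fst a" "fst a < n" for g a
  proof -
    obtain h where h: "h \<in> elementary n" "h [?k] = [a]" "h [a] = [inv_letter ?k]"
      "\<forall>c. fst c < n \<longrightarrow> fst c \<noteq> fst ?k \<longrightarrow> fst c \<noteq> fst a \<longrightarrow> h [c] = [c]"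
      using swap_letters[of ?k n a] Suc.prems a by auto
    note hA = elementary_AutF[OF h(1)]
    have gA: "g \<in> carrier (AutF n)" using g by (simp add: good_def)
    have app: "(g \<otimes>\<^bsub>AutF n\<^esub> h) [c] = g (h [c])" if "fst c < n" for c
      using gA hA that by (simp add: AutF_apply)
    have "permutes_letters n h" using swap_permutes_letters[OF hA _ a(2) h(2,3,4)] Suc.prems by simp
    then have "good (g \<otimes>\<^bsub>AutF n\<^esub> h)"
      using g hA h(4) a Suc.prems by (auto simp: good_def app permutes_letters_mult)
    then show ?thesis using h(1,2,3) app a Suc.prems by (intro bexI[of _ h]) auto
  qed
  obtain h where h: "h \<in> elementary n" and g: "good (f \<otimes>\<^bsub>AutF n\<^esub> h)"
    using Suc assms(2) elementary_AutF by (auto simp: good_def)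
  have fin: "\<exists>h'\<in>elementary n. good (g \<otimes>\<^bsub>AutF n\<^esub> h') \<and> (g \<otimes>\<^bsub>AutF n\<^esub> h') [?k] = [?k]"
    if g: "good g" for g
  proof -
    have gA: "g \<in> carrier (AutF n)" using g by (simp add: good_def)
    obtain a where a: "fst a < n" "g [a] = [?k]"
      using g Suc.prems permutes_lettersD[of n g ?k] by (auto simp: good_def)
    have "\<not> fst a < k"
    proof
      assume "fst a < k"
      then have "g [(fst a, True)] = [(fst a, True)]" using g by (simp add: good_def)
      moreover from this have "g [(fst a, False)] = [(fst a, False)]"
        using AutF_winv[OF gA, of "[(fst a, True)]"] a(1) by (simp add: inv_letter_def)
      ultimately have "g [a] = [a]" by (cases a; cases "snd a") auto
      then show False using a \<open>fst a < k\<close> by auto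
    qed
    then consider "a = ?k" | "a = inv_letter ?k" | "k < fst a"
      using same_generator[of a ?k] by (metis fst_conv linorder_neqE_nat)
    then show ?thesis
    proof cases
      case 1
      then show ?thesis using g a generate.one gA by (metis A.r_one)
    next
      case 2
      \<comment> \<open>Two quarter turns with the next generator: the first parks the letter sent
        to \<open>?k\<close> at \<open>?b\<close>, the second brings it back with the right
        sign.\<close>
      let ?b = "(Suc k, True)"
      obtain h1 where h1: "h1 \<in> elementary n" "good (g \<otimes>\<^bsub>AutF n\<^esub> h1)"
        "(g \<otimes>\<^bsub>AutF n\<^esub> h1) [?b] = g [inv_letter ?k]"
        using move[OF g, of ?b] Suc.prems by auto
      obtain h2 where h2: "h2 \<in> elementary n" "good (g \<otimes>\<^bsub>AutF n\<^esub> h1 \<otimes>\<^bsub>AutF n\<^esub> h2)"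
        "(g \<otimes>\<^bsub>AutF n\<^esub> h1 \<otimes>\<^bsub>AutF n\<^esub> h2) [?k] = (g \<otimes>\<^bsub>AutF n\<^esub> h1) [?b]"
        using move[OF h1(2), of ?b] Suc.prems by auto
      show ?thesis
        using h1 h2 2 a gA elementary_AutF elementary_mult
        by (intro bexI[of _ "h1 \<otimes>\<^bsub>AutF n\<^esub> h2"]) (auto simp: A.m_assoc)
    next
      case 3
      then show ?thesis using move[OF g 3 a(1)] a by auto
    qed
  qed
  obtain h' where h': "h' \<in> elementary n" "good (f \<otimes>\<^bsub>AutF n\<^esub> h \<otimes>\<^bsub>AutF n\<^esub> h')"
    "(f \<otimes>\<^bsub>AutF n\<^esub> h \<otimes>\<^bsub>AutF n\<^esub> h') [?k] = [?k]"
    using fin[OF g] by blast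
  have "f \<otimes>\<^bsub>AutF n\<^esub> h \<otimes>\<^bsub>AutF n\<^esub> h' = f \<otimes>\<^bsub>AutF n\<^esub> (h \<otimes>\<^bsub>AutF n\<^esub> h')"
    using assms h h'(1) elementary_AutF by (intro A.m_assoc)
  then show ?case using h h' elementary_mult
    by (intro bexI[of _ "h \<otimes>\<^bsub>AutF n\<^esub> h'"]) (auto simp: good_def less_Suc_eq)
qed

definition flip_last :: "nat \<Rightarrow> word \<Rightarrow> word" where
  "flip_last n = free_hom n (\<lambda>a. if Suc (fst a) = n then [inv_letter a] else [a])"

lemma flip_last_hom: "flip_last n \<in> hom (free_group n) (free_group n)"
  unfolding flip_last_def by (intro free_hom_hom) auto

lemma flip_last_letter:
  "fst a < n \<Longrightarrow> flip_last n [a] = (if Suc (fst a) = n then [inv_letter a] else [a])"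
  unfolding flip_last_def by (subst free_hom_letter) auto

lemma flip_last_AutF: "flip_last n \<in> carrier (AutF n)"
proof (rule AutF_memI[OF flip_last_hom _ flip_last_hom])
  show "flip_last n \<in> extensional (carrier (free_group n))"
    by (simp add: flip_last_def free_hom_def)
qed (simp_all add: flip_last_letter)

theorem nielsen:
  assumes "n > 0" "f \<in> carrier (AutF n)"
  shows "\<exists>h\<in>elementary n. f \<otimes>\<^bsub>AutF n\<^esub> h = \<one>\<^bsub>AutF n\<^esub> \<or> f \<otimes>\<^bsub>AutF n\<^esub> h = flip_last n"
proof -
  interpret A: group "AutF n" by (rule group_AutF)
  obtain h1 where h1: "h1 \<in> elementary n" "permutes_letters n (f \<otimes>\<^bsub>AutF n\<^esub> h1)"
    using nielsen_reduction assms by blast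
  have c1: "f \<otimes>\<^bsub>AutF n\<^esub> h1 \<in> carrier (AutF n)" using assms h1 elementary_AutF by simp
  obtain m where m: "n = Suc m" using assms(1) by (cases n) auto
  obtain h2 where h2: "h2 \<in> elementary n" "permutes_letters n (f \<otimes>\<^bsub>AutF n\<^esub> h1 \<otimes>\<^bsub>AutF n\<^esub> h2)"
    "\<forall>i<m. (f \<otimes>\<^bsub>AutF n\<^esub> h1 \<otimes>\<^bsub>AutF n\<^esub> h2) [(i, True)] = [(i, True)]"
    using sort_letters[of m n, OF _ c1 h1(2)] m by auto
  define g where "g = f \<otimes>\<^bsub>AutF n\<^esub> (h1 \<otimes>\<^bsub>AutF n\<^esub> h2)"
  have g_eq: "g = f \<otimes>\<^bsub>AutF n\<^esub> h1 \<otimes>\<^bsub>AutF n\<^esub> h2"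
    using assms h1(1) h2(1) elementary_AutF unfolding g_def by (intro A.m_assoc[symmetric])
  have gA: "g \<in> carrier (AutF n)" using assms h1 h2 elementary_AutF by (simp add: g_def)
  have fixed: "g [a] = [a]" if "fst a < m" for a
  proof -
    have 1: "g [(fst a, True)] = [(fst a, True)]" using h2(3) that by (simp add: g_eq)
    moreover from this have "g [(fst a, False)] = [(fst a, False)]"
      using AutF_winv[OF gA, of "[(fst a, True)]"] that m by (simp add: inv_letter_def)
    ultimately show ?thesis by (cases a; cases "snd a") auto
  qed
  obtain a where a: "fst a < n" "g [a] = [(m, True)]"
    using permutes_lettersD[OF h2(2), of "(m, True)"] m unfolding g_eq by auto
  \<comment> \<open>The other generators are fixed, so the last one can only go to itself or to its
    inverse.\<close>
  have "fst a = m" using fixed[of a] a m by (cases "fst a < m") auto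
  have "g = \<one>\<^bsub>AutF n\<^esub> \<or> g = flip_last n"
  proof (cases "snd a")
    case True
    then have "a = (m, True)" using \<open>fst a = m\<close> by (simp add: prod_eq_iff)
    then have "g [(i, True)] = \<one>\<^bsub>AutF n\<^esub> [(i, True)]" if "i < n" for i
      using that a fixed[of "(i, True)"] m by (cases "i = m") (auto simp: one_AutF)
    then show ?thesis using AutF_eqI[OF gA A.one_closed] by blast
  next
    case False
    then have "inv_letter a = (m, True)" using \<open>fst a = m\<close> by (simp add: prod_eq_iff)
    then have "g [(m, True)] = [inv_letter (m, True)]" using AutF_winv[OF gA, of "[a]"] a by simp
    then have "g [(i, True)] = flip_last n [(i, True)]" if "i < n" for i
      using that fixed[of "(i, True)"] m by (cases "i = m") (auto simp: flip_last_letter)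
    then show ?thesis using AutF_eqI[OF gA flip_last_AutF] by blast
  qed
  moreover have "h1 \<otimes>\<^bsub>AutF n\<^esub> h2 \<in> elementary n" using h1 h2 elementary_mult by blast
  ultimately show ?thesis unfolding g_def by (rule bexI)
qed

section \<open>Elementary generation of the special linear group\<close>

definition elementary_mats :: "nat \<Rightarrow> int mat set" where
  "elementary_mats n = abelianised_mat n ` elementary n"

lemma elementary_mats_carrier: "A \<in> elementary_mats n \<Longrightarrow> A \<in> carrier_mat n n"
  by (auto simp: elementary_mats_def)

lemma addcol_addcol:
  "k \<noteq> l \<Longrightarrow> A \<in> carrier_mat n n \<Longrightarrow> k < n \<Longrightarrow> l < n \<Longrightarrow>
    mat_addcol a k l (mat_addcol b k l A) = mat_addcol (a + b) k l (A :: int mat)"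
  by (rule eq_matI) (auto simp: algebra_simps)

lemma addcol_zero: "A \<in> carrier_mat n n \<Longrightarrow> mat_addcol 0 k l (A :: int mat) = A"
  by (rule eq_matI) auto

lemma addcol_carrier: "A \<in> carrier_mat n n \<Longrightarrow> mat_addcol a k l A \<in> carrier_mat n n"
  by (auto intro!: carrier_matI)

lemma elementary_mats_addcol_unit:
  assumes "A \<in> elementary_mats n" "k < n" "l < n" "k \<noteq> l"
  shows "mat_addcol (if b then 1 else - 1) k l A \<in> elementary_mats n"
proof -
  obtain h where h: "h \<in> elementary n" "A = abelianised_mat n h"
    using assms(1) by (auto simp: elementary_mats_def)
  have "mat_addcol (if b then 1 else - 1) k l A =
      abelianised_mat n (h \<otimes>\<^bsub>AutF n\<^esub> transvection n (k, b) (l, True))"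
    using abelianised_mat_mult_transvection[OF elementary_AutF[OF h(1)], of "(k, b)" "(l, True)"] assms h
    by simp
  moreover have "h \<otimes>\<^bsub>AutF n\<^esub> transvection n (k, b) (l, True) \<in> elementary n"
    using assms h by (intro elementary_mult transvection_elementary) auto
  ultimately show ?thesis by (simp add: elementary_mats_def)
qed

lemma elementary_mats_addcol:
  assumes A: "A \<in> elementary_mats n" and kl: "k < n" "l < n" "k \<noteq> l"
  shows "mat_addcol a k l A \<in> elementary_mats n"
proof (induction a rule: int_induct[of _ 0])
  case base
  then show ?case using A elementary_mats_carrier addcol_zero by metis
next
  case (step1 i)
  then show ?case
    using elementary_mats_addcol_unit[OF step1(2) kl, of True] addcol_addcol[of k l A n 1 i]
      elementary_mats_carrier[OF A] kl by (simp add: add.commute)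
next
  case (step2 i)
  then show ?case
    using elementary_mats_addcol_unit[OF step2(2) kl, of False] addcol_addcol[of k l A n "- 1" i]
      elementary_mats_carrier[OF A] kl by simp
qed

text \<open>Column operations are invertible, so a matrix may be replaced by a reduced one. The
  reduction lemmas below accordingly take the claim for reduced matrices as a hypothesis
  \<open>goal\<close>.\<close>

lemma elementary_mats_addcolD:
  assumes "mat_addcol a k l A \<in> elementary_mats n" "A \<in> carrier_mat n n" "k < n" "l < n" "k \<noteq> l"
  shows "A \<in> elementary_mats n"
  using elementary_mats_addcol[OF assms(1,3-5), of "- a"] addcol_addcol[of k l A n "- a" a]
    addcol_zero[of A n k l] assms by simp

section \<open>Euclidean reduction by columns\<close>

definition unimodular_rows :: "nat \<Rightarrow> nat \<Rightarrow> int mat \<Rightarrow> bool" where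
  "unimodular_rows n k A \<longleftrightarrow> A \<in> carrier_mat n n \<and> det A = 1 \<and>
    (\<forall>i<k. \<forall>j<n. A $$ (i, j) = (if i = j then 1 else 0))"

text \<open>The added column \<open>l\<close> vanishes in the first \<open>k\<close> rows because
  \<open>k \<le> l\<close>, so the rows already reduced stay as they are.\<close>

lemma unimodular_rows_addcol:
  assumes A: "unimodular_rows n k A" and "p < n" "l < n" "p \<noteq> l" "k \<le> l" "k \<le> n"
  shows "unimodular_rows n k (mat_addcol a p l A)"
proof -
  have "det (mat_addcol a p l A) = det A"
    using assms by (intro det_addcol) (auto simp: unimodular_rows_def)
  then show ?thesis using assms by (auto simp: unimodular_rows_def addcol_carrier)
qed

text \<open>Let \<open>B\<close> be the integral inverse of \<open>A\<close>. The first
  \<open>k\<close> rows of \<open>A\<close> being unit vectors, column \<open>k\<close> of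
  \<open>B\<close> vanishes above row \<open>k\<close>; row \<open>k\<close> of the product then
  reduces to \<open>A $$ (k, j) * B $$ (j, k) = 1\<close>.\<close>

lemma single_entry_unit:
  assumes A: "unimodular_rows n k A" and k: "k < n" and j: "k \<le> j" "j < n"
    and z: "\<And>i. k \<le> i \<Longrightarrow> i < n \<Longrightarrow> i \<noteq> j \<Longrightarrow> A $$ (k, i) = 0"
  shows "A $$ (k, j) = 1 \<or> A $$ (k, j) = - 1"
proof -
  have Ac: "A \<in> carrier_mat n n" using A by (simp add: unimodular_rows_def)
  define B where "B = adj_mat A"
  have Bc: "B \<in> carrier_mat n n" unfolding B_def by (rule adj_mat(1)[OF Ac])
  have "A * B = 1\<^sub>m n"
    using adj_mat(2)[OF Ac] A by (simp add: B_def unimodular_rows_def) (auto intro!: eq_matI)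
  moreover have "(A * B) $$ (i, k) = (\<Sum>m<n. A $$ (i, m) * B $$ (m, k))" if "i < n" for i
    using that k Ac Bc by (simp add: scalar_prod_def lessThan_atLeast0)
  ultimately have AB: "(\<Sum>m<n. A $$ (i, m) * B $$ (m, k)) = (if i = k then 1 else 0)" if "i < n" for i
    using that k by (metis index_one_mat(1))
  have B0: "B $$ (i, k) = 0" if "i < k" for i
  proof -
    have "(\<Sum>m<n. A $$ (i, m) * B $$ (m, k)) = (\<Sum>m<n. if m = i then B $$ (m, k) else 0)"
      using A that by (intro sum.cong) (auto simp: unimodular_rows_def)
    then show ?thesis using AB[of i] that k by simp
  qed
  have "(\<Sum>m<n. A $$ (k, m) * B $$ (m, k)) = (\<Sum>m<n. if m = j then A $$ (k, m) * B $$ (m, k) else 0)"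
  proof (intro sum.cong refl)
    fix m assume "m \<in> {..<n}"
    then show "A $$ (k, m) * B $$ (m, k) = (if m = j then A $$ (k, m) * B $$ (m, k) else 0)"
      using B0[of m] z[of m] by (cases "m < k") auto
  qed
  then have "A $$ (k, j) * B $$ (j, k) = 1" using AB[of k] k j by simp
  then show ?thesis by (auto simp: zmult_eq_1_iff)
qed

text \<open>\<open>J\<close> holds the columns where row \<open>k\<close> may still be nonzero; the
  pivot 1 clears them one at a time, those to the left of \<open>k\<close> included.\<close>

lemma clear_row:
  assumes "finite J" "J \<subseteq> {..<n} - {k}" "k < n" "unimodular_rows n k A" "A $$ (k, k) = 1"
    "\<And>j. j < n \<Longrightarrow> j \<notin> J \<Longrightarrow> j \<noteq> k \<Longrightarrow> A $$ (k, j) = 0"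
    and goal: "\<And>B. unimodular_rows n (Suc k) B \<Longrightarrow> B \<in> elementary_mats n"
  shows "A \<in> elementary_mats n"
  using assms(1-6)
proof (induction J arbitrary: A rule: finite_induct)
  case empty
  then have "unimodular_rows n (Suc k) A" by (auto simp: unimodular_rows_def less_Suc_eq)
  then show ?case by (rule goal)
next
  case (insert j J)
  have j: "j < n" "j \<noteq> k" using insert.prems by auto
  have Ac: "A \<in> carrier_mat n n" using insert.prems by (simp add: unimodular_rows_def)
  have "mat_addcol (- A $$ (k, j)) j k A \<in> elementary_mats n"
  proof (rule insert.IH)
    show "unimodular_rows n k (mat_addcol (- A $$ (k, j)) j k A)"
      using insert.prems j by (intro unimodular_rows_addcol) auto
    show "mat_addcol (- A $$ (k, j)) j k A $$ (k, i) = 0" if "i < n" "i \<notin> J" "i \<noteq> k" for i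
      using that insert.prems Ac j by (cases "i = j") auto
  qed (use insert.prems Ac j in auto)
  then show ?case using elementary_mats_addcolD Ac j insert.prems(2) by blast
qed

lemma euclid_row:
  assumes A: "unimodular_rows n k A" and k: "k < n"
    and goal: "\<And>B j. unimodular_rows n k B \<Longrightarrow> k \<le> j \<Longrightarrow> j < n \<Longrightarrow>
      (\<And>i. k \<le> i \<Longrightarrow> i < n \<Longrightarrow> i \<noteq> j \<Longrightarrow> B $$ (k, i) = 0) \<Longrightarrow> B \<in> elementary_mats n"
  shows "A \<in> elementary_mats n"
  using A
proof (induction "\<Sum>j\<in>{k..<n}. nat \<bar>A $$ (k, j)\<bar>" arbitrary: A rule: less_induct)
  case less
  have Ac: "A \<in> carrier_mat n n" using less.prems by (simp add: unimodular_rows_def)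
  show ?case
  proof (cases "\<exists>i j. k \<le> i \<and> i < n \<and> k \<le> j \<and> j < n \<and> i \<noteq> j \<and> A $$ (k, i) \<noteq> 0 \<and> A $$ (k, j) \<noteq> 0")
    case True
    then obtain i j where ij: "k \<le> i" "i < n" "k \<le> j" "j < n" "i \<noteq> j" "A $$ (k, i) \<noteq> 0"
      "A $$ (k, j) \<noteq> 0" "\<bar>A $$ (k, i)\<bar> \<le> \<bar>A $$ (k, j)\<bar>"
      by (metis linorder_linear)
    \<comment> \<open>One subtractive Euclidean step: the entry of smaller absolute value is added
      or subtracted once, with the sign that brings the larger one closer to zero.\<close>
    define c where "c = - sgn (A $$ (k, i)) * sgn (A $$ (k, j))"
    have lt: "\<bar>c * A $$ (k, i) + A $$ (k, j)\<bar> < \<bar>A $$ (k, j)\<bar>"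
      using ij(6-8) by (auto simp: c_def sgn_if split: if_splits)
    have "(\<Sum>m\<in>{k..<n}. nat \<bar>mat_addcol c j i A $$ (k, m)\<bar>) < (\<Sum>m\<in>{k..<n}. nat \<bar>A $$ (k, m)\<bar>)"
    proof (rule sum_strict_mono_ex1)
      show "\<forall>m\<in>{k..<n}. nat \<bar>mat_addcol c j i A $$ (k, m)\<bar> \<le> nat \<bar>A $$ (k, m)\<bar>"
        using lt Ac k ij by auto
      show "\<exists>m\<in>{k..<n}. nat \<bar>mat_addcol c j i A $$ (k, m)\<bar> < nat \<bar>A $$ (k, m)\<bar>"
        using lt Ac k ij by (intro bexI[of _ j]) auto
    qed simp
    moreover have "unimodular_rows n k (mat_addcol c j i A)"
      using less.prems ij k by (intro unimodular_rows_addcol) auto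
    ultimately have "mat_addcol c j i A \<in> elementary_mats n" by (rule less.hyps)
    then show ?thesis using elementary_mats_addcolD Ac ij by blast
  next
    case False
    \<comment> \<open>The position of the only nonzero entry from column \<open>k\<close> on. The
      default \<open>k\<close> covers a vanishing row, which \<open>single_entry_unit\<close> later
      rules out through the determinant.\<close>
    define j where "j = (if \<exists>j\<ge>k. j < n \<and> A $$ (k, j) \<noteq> 0 then SOME j. k \<le> j \<and> j < n \<and> A $$ (k, j) \<noteq> 0 else k)"
    have j: "k \<le> j \<and> j < n \<and> ((\<exists>j\<ge>k. j < n \<and> A $$ (k, j) \<noteq> 0) \<longrightarrow> A $$ (k, j) \<noteq> 0)"
    proof (cases "\<exists>j\<ge>k. j < n \<and> A $$ (k, j) \<noteq> 0")
      case True
      then have "k \<le> j \<and> j < n \<and> A $$ (k, j) \<noteq> 0"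
        unfolding j_def if_P[OF True] by (rule someI_ex)
      then show ?thesis by blast
    next
      case False
      then show ?thesis using k unfolding j_def if_not_P[OF False] by blast
    qed
    show ?thesis
    proof (rule goal[OF less.prems, of j])
      show "A $$ (k, i) = 0" if "k \<le> i" "i < n" "i \<noteq> j" for i
        using False j that by blast
    qed (use j in auto)
  qed
qed

lemma pivot_row:
  assumes A: "unimodular_rows n k A" and k: "Suc k < n"
    and goal: "\<And>B. unimodular_rows n k B \<Longrightarrow> B $$ (k, k) = 1 \<Longrightarrow> B \<in> elementary_mats n"
  shows "A \<in> elementary_mats n"
proof (rule euclid_row[OF A])
  fix B j
  assume B: "unimodular_rows n k B" and j: "k \<le> j" "j < n"
    and z: "\<And>i. k \<le> i \<Longrightarrow> i < n \<Longrightarrow> i \<noteq> j \<Longrightarrow> B $$ (k, i) = 0"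
  have Bc: "B \<in> carrier_mat n n" using B by (simp add: unimodular_rows_def)
  have unit: "B $$ (k, j) = 1 \<or> B $$ (k, j) = - 1"
    using single_entry_unit[OF B _ j z] k by simp
  consider "j \<noteq> k" | "j = k" "B $$ (k, k) = 1" | "j = k" "B $$ (k, k) = - 1"
    using unit by blast
  then show "B \<in> elementary_mats n"
  proof cases
    case 1
    \<comment> \<open>Column \<open>k\<close> has entry 0 in this row, and the added multiple
      contributes the square of a unit, which is 1.\<close>
    have "mat_addcol (B $$ (k, j)) k j B \<in> elementary_mats n"
    proof (rule goal)
      show "unimodular_rows n k (mat_addcol (B $$ (k, j)) k j B)"
        using B j k 1 by (intro unimodular_rows_addcol) auto
      show "mat_addcol (B $$ (k, j)) k j B $$ (k, k) = 1"
        using unit z[of k] 1 Bc k j by auto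
    qed
    then show ?thesis using elementary_mats_addcolD[OF _ Bc] 1 j k by auto
  next
    case 2
    then show ?thesis using goal B by blast
  next
    case 3
    \<comment> \<open>The pivot -1 is first copied into the spare column \<open>Suc k\<close>;
      subtracting that column twice then gives \<open>- 1 + 2 = 1\<close>.\<close>
    let ?C = "mat_addcol 1 (Suc k) k B"
    have C: "unimodular_rows n k ?C" by (rule unimodular_rows_addcol[OF B]) (use k in auto)
    have Cc: "?C \<in> carrier_mat n n" using Bc by (rule addcol_carrier)
    have "mat_addcol (- 2) k (Suc k) ?C \<in> elementary_mats n"
    proof (rule goal)
      show "unimodular_rows n k (mat_addcol (- 2) k (Suc k) ?C)"
        by (rule unimodular_rows_addcol[OF C]) (use k in auto)
      show "mat_addcol (- 2) k (Suc k) ?C $$ (k, k) = 1"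
        using 3 z[of "Suc k"] Bc k by simp
    qed
    then have "?C \<in> elementary_mats n" using elementary_mats_addcolD[OF _ Cc] k by auto
    then show ?thesis using elementary_mats_addcolD[OF _ Bc] k by auto
  qed
qed (use k in simp)

lemma unimodular_rows_elementary:
  assumes "unimodular_rows n k A" "k \<le> n" "n > 0"
  shows "A \<in> elementary_mats n"
  using assms(2,1)
proof (induction k arbitrary: A rule: inc_induct)
  case base
  then have "A = 1\<^sub>m n" by (intro eq_matI) (auto simp: unimodular_rows_def)
  moreover have "abelianised_mat n \<one>\<^bsub>AutF n\<^esub> \<in> elementary_mats n"
    unfolding elementary_mats_def by (intro imageI generate.one)
  ultimately show ?case by (simp add: abelianised_mat_one)
next
  case (step k)
  have k: "k < n" using step by simp
  show ?case
  proof (cases "Suc k = n")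
    case True
    have Ac: "A \<in> carrier_mat n n" using step.prems by (simp add: unimodular_rows_def)
    \<comment> \<open>The last row has no spare column for repairing a sign, but here
      \<open>A\<close> is lower triangular and its determinant equals the pivot.\<close>
    have "det A = prod_list (diag_mat A)"
    proof (rule det_lower_triangular[OF _ Ac])
      fix i j assume "i < j" "j < n"
      then show "A $$ (i, j) = 0" using step.prems True by (auto simp: unimodular_rows_def)
    qed
    also have "\<dots> = (\<Prod>i = 0..<Suc k. A $$ (i, i))" using Ac True by (simp add: prod_list_diag_prod)
    also have "\<dots> = A $$ (k, k)"
      using step.prems k by (simp add: unimodular_rows_def)
    finally have "A $$ (k, k) = 1" using step.prems by (simp add: unimodular_rows_def)
    then show ?thesis
      using clear_row[of "{..<n} - {k}" n k A] step k by auto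
  next
    case False
    then have "Suc k < n" using k by simp
    then show ?thesis
    proof (rule pivot_row[OF step.prems])
      fix B assume "unimodular_rows n k B" "B $$ (k, k) = 1"
      then show "B \<in> elementary_mats n"
        using clear_row[of "{..<n} - {k}" n k B] step.IH k by auto
    qed
  qed
qed

theorem SL_int_elementary:
  assumes "n > 0"
  shows "carrier (SL_int n) \<subseteq> abelianised_mat n ` elementary n"
proof
  fix A assume "A \<in> carrier (SL_int n)"
  then have "unimodular_rows n 0 A" by (simp add: SL_int_def unimodular_rows_def)
  then show "A \<in> abelianised_mat n ` elementary n"
    using unimodular_rows_elementary assms by (auto simp: elementary_mats_def)
qed

section \<open>Special and inner automorphisms\<close>

lemma aut_sign_mult:
  "f \<in> carrier (AutF n) \<Longrightarrow> g \<in> carrier (AutF n) \<Longrightarrow>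
    aut_sign n (f \<otimes>\<^bsub>AutF n\<^esub> g) = aut_sign n f * aut_sign n g"
  by (simp add: aut_sign_def abelianised_mat_mult det_mult[of _ n])

lemma aut_sign_one: "aut_sign n \<one>\<^bsub>AutF n\<^esub> = 1"
  by (simp add: aut_sign_def abelianised_mat_one)

abbreviation special :: "nat \<Rightarrow> (word \<Rightarrow> word) set" where
  "special n \<equiv> {f \<in> carrier (AutF n). aut_sign n f = 1}"

lemma subgroup_special: "subgroup (special n) (AutF n)"
proof -
  interpret A: group "AutF n" by (rule group_AutF)
  show ?thesis
  proof (rule A.subgroupI)
    show "special n \<noteq> {}" using aut_sign_one A.one_closed by blast
    fix f g assume f: "f \<in> special n"
    then have "aut_sign n f * aut_sign n (inv\<^bsub>AutF n\<^esub> f) = 1"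
      using aut_sign_mult[of f n "inv\<^bsub>AutF n\<^esub> f"] by (simp add: aut_sign_one)
    then show "inv\<^bsub>AutF n\<^esub> f \<in> special n" using f by simp
    assume "g \<in> special n"
    then show "f \<otimes>\<^bsub>AutF n\<^esub> g \<in> special n" using f by (simp add: aut_sign_mult)
  qed auto
qed

lemma aut_sign_transvection:
  assumes "fst d < n" "fst l < n" "fst d \<noteq> fst l"
  shows "aut_sign n (transvection n d l) = 1"
proof -
  interpret A: group "AutF n" by (rule group_AutF)
  have "abelianised_mat n (transvection n d l) =
      mat_addcol (letter_sign d * letter_sign l) (fst d) (fst l) (1\<^sub>m n)"
    using abelianised_mat_mult_transvection[OF A.one_closed assms] transvection_AutF[OF assms]
    by (simp add: abelianised_mat_one)
  then show ?thesis using det_addcol[OF assms(2,3), of "1\<^sub>m n :: int mat"] by (simp add: aut_sign_def)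
qed

lemma transvections_special: "transvections n \<subseteq> special n"
  using transvections_AutF by (auto simp: transvections_def aut_sign_transvection simp del: split_paired_Ex)

lemma aut_sign_flip_last:
  assumes "n > 0"
  shows "aut_sign n (flip_last n) = - 1"
proof -
  obtain m where m: "n = Suc m" using assms by (cases n) auto
  let ?M = "abelianised_mat n (flip_last n)"
  have "det ?M = prod_list (diag_mat ?M)"
    by (rule det_lower_triangular[of n]) (auto simp: flip_last_letter)
  also have "\<dots> = (\<Prod>i = 0..<Suc m. if i = m then - 1 else 1)"
    unfolding prod_list_diag_prod abelianised_mat_dim m
    by (intro prod.cong) (auto simp: flip_last_letter)
  also have "\<dots> = - 1" by simp
  finally show ?thesis by (simp add: aut_sign_def)
qed

text \<open>\<open>nielsen\<close> leaves either the identity or \<open>flip_last\<close>, and the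
  determinant excludes the latter.\<close>

lemma generate_special:
  assumes "n > 0"
  shows "generate (AutF n) (transvections n) = special n"
proof
  interpret A: group "AutF n" by (rule group_AutF)
  show "elementary n \<subseteq> special n"
    by (rule A.generate_subgroup_incl[OF transvections_special subgroup_special])
  show "special n \<subseteq> elementary n"
  proof
    fix f assume f: "f \<in> special n"
    obtain h where h: "h \<in> elementary n" "f \<otimes>\<^bsub>AutF n\<^esub> h = \<one>\<^bsub>AutF n\<^esub> \<or> f \<otimes>\<^bsub>AutF n\<^esub> h = flip_last n"
      using nielsen[OF assms] f by blast
    have "aut_sign n (f \<otimes>\<^bsub>AutF n\<^esub> h) = 1"
      using f h(1) \<open>elementary n \<subseteq> special n\<close> by (auto simp: aut_sign_mult)
    then have "f \<otimes>\<^bsub>AutF n\<^esub> h = \<one>\<^bsub>AutF n\<^esub>" using h(2) aut_sign_flip_last[OF assms] by auto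
    then have "f = inv\<^bsub>AutF n\<^esub> h"
      using f elementary_AutF[OF h(1)] by (simp add: A.inv_equality)
    then show "f \<in> elementary n"
      using A.generate_m_inv_closed[OF transvections_AutF h(1)] by simp
  qed
qed

lemma generate_AutF:
  assumes "n > 0"
  shows "generate (AutF n) (insert (flip_last n) (transvections n)) = carrier (AutF n)"
    (is "generate _ ?T = _")
proof
  interpret A: group "AutF n" by (rule group_AutF)
  have T: "?T \<subseteq> carrier (AutF n)" using transvections_AutF flip_last_AutF by blast
  show "generate (AutF n) ?T \<subseteq> carrier (AutF n)" by (rule A.generate_incl[OF T])
  show "carrier (AutF n) \<subseteq> generate (AutF n) ?T"
  proof
    fix f assume f: "f \<in> carrier (AutF n)"
    obtain h where h: "h \<in> elementary n" "f \<otimes>\<^bsub>AutF n\<^esub> h = \<one>\<^bsub>AutF n\<^esub> \<or> f \<otimes>\<^bsub>AutF n\<^esub> h = flip_last n"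
      using nielsen[OF assms f] by blast
    have "h \<in> generate (AutF n) ?T" using h(1) A.mono_generate[of "transvections n" ?T] by blast
    then have "inv\<^bsub>AutF n\<^esub> h \<in> generate (AutF n) ?T" by (rule A.generate_m_inv_closed[OF T])
    moreover have "f \<otimes>\<^bsub>AutF n\<^esub> h \<in> generate (AutF n) ?T"
      using h(2) generate.one generate.incl[of "flip_last n" ?T "AutF n"] by auto
    ultimately have "f \<otimes>\<^bsub>AutF n\<^esub> h \<otimes>\<^bsub>AutF n\<^esub> inv\<^bsub>AutF n\<^esub> h \<in> generate (AutF n) ?T"
      by (rule generate.eng[rotated])
    moreover have "f \<otimes>\<^bsub>AutF n\<^esub> h \<otimes>\<^bsub>AutF n\<^esub> inv\<^bsub>AutF n\<^esub> h = f"
      using f elementary_AutF[OF h(1)] by (simp add: A.m_assoc)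
    ultimately show "f \<in> generate (AutF n) ?T" by simp
  qed
qed

section \<open>Inner automorphisms\<close>

definition conjugation :: "nat \<Rightarrow> word \<Rightarrow> word \<Rightarrow> word" where
  "conjugation n g = (\<lambda>x\<in>carrier (free_group n).
     g \<otimes>\<^bsub>free_group n\<^esub> x \<otimes>\<^bsub>free_group n\<^esub> inv\<^bsub>free_group n\<^esub> g)"

lemma Inn_conjugation: "Inn (free_group n) = conjugation n ` carrier (free_group n)"
  by (simp add: Inn_def conjugation_def)

context
  fixes n :: nat
begin

interpretation F: group "free_group n" by (rule group_free_group)
interpretation A: group "AutF n" by (rule group_AutF)

lemma conjugation_hom_self:
  "g \<in> carrier (free_group n) \<Longrightarrow> conjugation n g \<in> hom (free_group n) (free_group n)"
  by (auto simp: conjugation_def hom_def F.m_assoc F.inv_solve_left' simp del: one_free_group)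
     (simp add: F.m_assoc[symmetric] del: one_free_group)

lemma conjugation_AutF:
  assumes g: "g \<in> carrier (free_group n)"
  shows "conjugation n g \<in> carrier (AutF n)"
proof (rule AutF_memI[where g = "conjugation n (inv\<^bsub>free_group n\<^esub> g)"])
  show "conjugation n g \<in> extensional (carrier (free_group n))"
    by (simp add: conjugation_def)
next
  fix i assume "i < n"
  then have i: "[(i, True)] \<in> carrier (free_group n)" by simp
  show "conjugation n g (conjugation n (inv\<^bsub>free_group n\<^esub> g) [(i, True)]) = [(i, True)]"
    using g i unfolding conjugation_def
    by (simp add: F.m_assoc del: one_free_group letter_carrier)
       (simp add: F.m_assoc[symmetric] del: one_free_group letter_carrier)
  show "conjugation n (inv\<^bsub>free_group n\<^esub> g) (conjugation n g [(i, True)]) = [(i, True)]"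
    using g i unfolding conjugation_def
    by (simp add: F.m_assoc del: one_free_group letter_carrier)
       (simp add: F.m_assoc[symmetric] del: one_free_group letter_carrier)
qed (use g conjugation_hom_self in auto)

lemma conjugation_hom: "group_hom (free_group n) (AutF n) (conjugation n)"
proof (unfold_locales, rule homI)
  fix g h assume g: "g \<in> carrier (free_group n)" and h: "h \<in> carrier (free_group n)"
  show "conjugation n (g \<otimes>\<^bsub>free_group n\<^esub> h) = conjugation n g \<otimes>\<^bsub>AutF n\<^esub> conjugation n h"
  proof (rule AutF_eqI)
    fix i assume "i < n"
    then have "[(i, True)] \<in> carrier (free_group n)" by simp
    then show "conjugation n (g \<otimes>\<^bsub>free_group n\<^esub> h) [(i, True)] =
        (conjugation n g \<otimes>\<^bsub>AutF n\<^esub> conjugation n h) [(i, True)]"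
      using g h conjugation_AutF
      by (simp add: AutF_apply conjugation_def F.m_assoc F.inv_mult_group del: letter_carrier)
  qed (use g h conjugation_AutF in auto)
qed (rule conjugation_AutF)

text \<open>Applying \<open>f\<close> after conjugation by \<open>g\<close> is conjugation by
  \<open>f g\<close> after \<open>f\<close>.\<close>

lemma normal_Inn: "Inn (free_group n) \<lhd> AutF n"
  unfolding A.normal_inv_iff
proof (intro conjI ballI)
  interpret group_hom "free_group n" "AutF n" "conjugation n" by (rule conjugation_hom)
  show "subgroup (Inn (free_group n)) (AutF n)"
    unfolding Inn_conjugation by (rule img_is_subgroup)
  fix f k assume f: "f \<in> carrier (AutF n)" and "k \<in> Inn (free_group n)"
  then obtain g where g: "g \<in> carrier (free_group n)" "k = conjugation n g"
    by (auto simp: Inn_conjugation)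
  interpret f: group_hom "free_group n" "free_group n" f
    using AutF_hom[OF f] by (simp add: group_hom_def group_hom_axioms_def group_free_group)
  note c = conjugation_AutF[OF g(1)] conjugation_AutF[OF AutF_closed[OF f g(1)]]
  have "f \<otimes>\<^bsub>AutF n\<^esub> k = conjugation n (f g) \<otimes>\<^bsub>AutF n\<^esub> f"
  proof (rule AutF_eqI)
    fix i assume "i < n"
    then have i: "[(i, True)] \<in> carrier (free_group n)" by simp
    then show "(f \<otimes>\<^bsub>AutF n\<^esub> k) [(i, True)] = (conjugation n (f g) \<otimes>\<^bsub>AutF n\<^esub> f) [(i, True)]"
      using f g c AutF_closed[OF f] by (simp add: AutF_apply conjugation_def del: letter_carrier)
  qed (use f g c in auto)
  then have "f \<otimes>\<^bsub>AutF n\<^esub> k \<otimes>\<^bsub>AutF n\<^esub> inv\<^bsub>AutF n\<^esub> f = conjugation n (f g)"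
    using f c by (simp add: A.m_assoc)
  then show "f \<otimes>\<^bsub>AutF n\<^esub> k \<otimes>\<^bsub>AutF n\<^esub> inv\<^bsub>AutF n\<^esub> f \<in> Inn (free_group n)"
    using AutF_closed[OF f g(1)] by (simp add: Inn_conjugation)
qed

text \<open>Exponent sums of \<open>g\<close> and its inverse cancel. Hence the abelianised matrix
  is still an invariant modulo inner automorphisms.\<close>

lemma abelianised_mat_Inn:
  assumes "k \<in> Inn (free_group n)"
  shows "abelianised_mat n k = 1\<^sub>m n"
proof -
  obtain g where g: "g \<in> carrier (free_group n)" "k = conjugation n g"
    using assms by (auto simp: Inn_conjugation)
  have "exponent_sum i (g \<otimes>\<^bsub>free_group n\<^esub> inv\<^bsub>free_group n\<^esub> g) = 0" for i
    using F.r_inv[OF g(1)] by simp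
  then have "exponent_sum i g + exponent_sum i (inv\<^bsub>free_group n\<^esub> g) = 0" for i
    by (simp add: exponent_sum_mult)
  then show ?thesis
    by (intro eq_matI) (auto simp: g(2) conjugation_def exponent_sum_mult algebra_simps)
qed

lemma Inn_special: "Inn (free_group n) \<subseteq> special n"
  using abelianised_mat_Inn conjugation_AutF by (auto simp: aut_sign_def Inn_conjugation)

end

lemma group_SL_int: "group (SL_int n)"
proof (rule groupI)
  fix A assume A: "A \<in> carrier (SL_int n)"
  then have Ac: "A \<in> carrier_mat n n" and d: "det A = 1" by (auto simp: SL_int_def)
  have one: "(1 :: int) \<cdot>\<^sub>m 1\<^sub>m n = 1\<^sub>m n" by (rule eq_matI) auto
  note adj = adj_mat[OF Ac, unfolded d one]
  have "det (adj_mat A) * det A = 1"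
    using det_mult[OF adj(1) Ac] adj(3) by simp
  then show "\<exists>B\<in>carrier (SL_int n). B \<otimes>\<^bsub>SL_int n\<^esub> A = \<one>\<^bsub>SL_int n\<^esub>"
    using adj d by (intro bexI[of _ "adj_mat A"]) (auto simp: SL_int_def)
qed (auto simp: SL_int_def det_mult[of _ n])

section \<open>One-endedness\<close>

definition independent_transvections :: "nat \<Rightarrow> (word \<Rightarrow> word) \<Rightarrow> (word \<Rightarrow> word) \<Rightarrow> bool" where
  "independent_transvections n s t \<longleftrightarrow> (\<exists>d l d' l'. s = transvection n d l \<and> t = transvection n d' l' \<and>
     fst d < n \<and> fst l < n \<and> fst d' < n \<and> fst l' < n \<and> fst d \<noteq> fst l \<and> fst d' \<noteq> fst l' \<and>
     fst d \<noteq> fst d' \<and> fst d \<noteq> fst l' \<and> fst d' \<noteq> fst l)"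

lemma fresh_index:
  assumes "finite A" "card A < n"
  shows "\<exists>p::nat<n. p \<notin> A"
proof (rule ccontr)
  assume "\<not> ?thesis"
  then have "{..<n} \<subseteq> A" by auto
  then have "card {..<n} \<le> card A" using assms(1) by (rule card_mono[rotated])
  then show False using assms(2) by simp
qed

text \<open>This is where \<open>n \<ge> 5\<close> enters: the moved index \<open>p\<close> avoids
  up to four indices. The multiplier \<open>q\<close> only has to avoid \<open>p\<close> and the two
  other moved indices.\<close>

lemma independent_transvections_link:
  assumes n: "n \<ge> 5" and s: "s \<in> transvections n" "s' \<in> transvections n"
  shows "\<exists>u\<in>transvections n. independent_transvections n s u \<and> independent_transvections n u s'"
proof -
  obtain d l where d: "s = transvection n d l" "fst d < n" "fst l < n" "fst d \<noteq> fst l"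
    using s(1) by (auto simp: transvections_def)
  obtain d' l' where d': "s' = transvection n d' l'" "fst d' < n" "fst l' < n" "fst d' \<noteq> fst l'"
    using s(2) by (auto simp: transvections_def)
  have "card {fst d, fst l, fst d', fst l'} \<le> 4"
    by (simp add: card_insert_if)
  then obtain p where p: "p < n" "p \<notin> {fst d, fst l, fst d', fst l'}"
    using fresh_index[of "{fst d, fst l, fst d', fst l'}" n] n by auto
  have "card {fst d, fst d', p} \<le> 3"
    by (simp add: card_insert_if)
  then obtain q where q: "q < n" "q \<notin> {fst d, fst d', p}"
    using fresh_index[of "{fst d, fst d', p}" n] n by auto
  let ?u = "transvection n (p, True) (q, True)"
  have "?u \<in> transvections n" using p q by (intro transvectionsI) auto
  moreover have "independent_transvections n s ?u"
    unfolding independent_transvections_def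
    by (rule exI[of _ d], rule exI[of _ l], rule exI[of _ "(p, True)"], rule exI[of _ "(q, True)"])
       (use p q d in auto)
  moreover have "independent_transvections n ?u s'"
    unfolding independent_transvections_def
    by (rule exI[of _ "(p, True)"], rule exI[of _ "(q, True)"], rule exI[of _ d'], rule exI[of _ l'])
       (use p q d' in auto)
  ultimately show ?thesis by blast
qed

text \<open>For \<open>n \<ge> 3\<close> the indices 0 and 1 differ from the last one, so this
  transvection does not see the flip. It gives the conjugation condition for the generator outside
  the transvections.\<close>

lemma flip_last_commute:
  assumes "n \<ge> 3"
  shows "\<exists>s\<in>transvections n. flip_last n \<otimes>\<^bsub>AutF n\<^esub> s = s \<otimes>\<^bsub>AutF n\<^esub> flip_last n"
proof
  interpret A: group "AutF n" by (rule group_AutF)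
  let ?s = "transvection n (0, True) (1, True)"
  show s: "?s \<in> transvections n" using assms by (intro transvectionsI) auto
  then have sA: "?s \<in> carrier (AutF n)" using transvections_AutF by blast
  show "flip_last n \<otimes>\<^bsub>AutF n\<^esub> ?s = ?s \<otimes>\<^bsub>AutF n\<^esub> flip_last n"
  proof (rule AutF_eqI)
    fix i assume i: "i < n"
    have "[(1, True), (0, True)] = [(1, True)] \<otimes>\<^bsub>free_group n\<^esub> [(0, True)]"
      by (simp add: mult_letter inv_letter_def)
    then have "flip_last n [(1, True), (0, True)] = [(1, True), (0, True)]"
      using assms by (simp add: AutF_mult[OF flip_last_AutF] flip_last_letter)
    then show "(flip_last n \<otimes>\<^bsub>AutF n\<^esub> ?s) [(i, True)] = (?s \<otimes>\<^bsub>AutF n\<^esub> flip_last n) [(i, True)]"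
      using assms i sA flip_last_AutF
      by (auto simp: AutF_apply transvection_letter flip_last_letter inv_letter_def)
  qed (use sA flip_last_AutF in auto)
qed

text \<open>The common source of all five cases: \<open>K\<close> is the full or the special
  automorphism group, \<open>T\<close> the transvections with or without the flip, and
  \<open>h\<close> any surjection through which the abelianised matrix factors.\<close>

lemma one_ended_image:
  assumes n: "n \<ge> 5" and K: "subgroup K (AutF n)"
    and h: "group_hom (AutF n\<lparr>carrier := K\<rparr>) H h" and surj: "h ` K = carrier H"
    and T: "transvections n \<subseteq> T" "T \<subseteq> insert (flip_last n) (transvections n)" "T \<subseteq> K"
    and gen: "generate (AutF n) T = K"
    and inv: "\<And>a b. a \<in> K \<Longrightarrow> b \<in> K \<Longrightarrow> h a = h b \<Longrightarrow> abelianised_mat n a = abelianised_mat n b"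
  shows "one_ended H"
proof -
  interpret A: group "AutF n" by (rule group_AutF)
  interpret h: group_hom "AutF n\<lparr>carrier := K\<rparr>" H h by (rule h)
  show ?thesis
  proof (rule h.one_ended_surj[where T = T and S = "transvections n" and
        \<phi> = "abelianised_mat n" and R = "independent_transvections n"])
    show "finite T" using T(2) finite_transvections finite_subset by blast
    show "generate (AutF n\<lparr>carrier := K\<rparr>) T = carrier (AutF n\<lparr>carrier := K\<rparr>)"
      using A.generate_consistent[OF T(3) K] gen by simp
    show "transvections n \<noteq> {}"
      using flip_last_commute[of n] n by auto
    show "\<exists>u\<in>transvections n. independent_transvections n s u \<and> independent_transvections n u s'"
      if "s \<in> transvections n" "s' \<in> transvections n" for s s'
      using independent_transvections_link n that by blast
    show "s \<otimes>\<^bsub>AutF n\<lparr>carrier := K\<rparr>\<^esub> t = t \<otimes>\<^bsub>AutF n\<lparr>carrier := K\<rparr>\<^esub> s \<and>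
        inj (\<lambda>(i::nat, j::nat). abelianised_mat n (s [^]\<^bsub>AutF n\<lparr>carrier := K\<rparr>\<^esub> i
          \<otimes>\<^bsub>AutF n\<lparr>carrier := K\<rparr>\<^esub> t [^]\<^bsub>AutF n\<lparr>carrier := K\<rparr>\<^esub> j))"
      if "independent_transvections n s t" for s t
      using that transvection_commute transvection_indep
      unfolding independent_transvections_def A.nat_pow_consistent[symmetric] by auto
    show "\<exists>s\<in>transvections n. \<exists>s'\<in>transvections n.
        y \<otimes>\<^bsub>AutF n\<lparr>carrier := K\<rparr>\<^esub> s = s' \<otimes>\<^bsub>AutF n\<lparr>carrier := K\<rparr>\<^esub> y" if "y \<in> T" for y
      \<comment> \<open>A transvection \<open>y\<close> commutes with itself; the flip is covered by
        \<open>flip_last_commute\<close>.\<close>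
      using that T(2) flip_last_commute[of n] n by fastforce
    show "h ` carrier (AutF n\<lparr>carrier := K\<rparr>) = carrier H" using surj by simp
    show "T \<subseteq> carrier (AutF n\<lparr>carrier := K\<rparr>)" using T(3) by simp
    show "abelianised_mat n a = abelianised_mat n b"
      if "a \<in> carrier (AutF n\<lparr>carrier := K\<rparr>)" "b \<in> carrier (AutF n\<lparr>carrier := K\<rparr>)" "h a = h b" for a b
      by (rule inv) (use that in simp_all)
  qed (rule T(1))
qed

lemma one_ended_quotient:
  assumes n: "n \<ge> 5" and K: "subgroup K (AutF n)" "Inn (free_group n) \<subseteq> K"
    and T: "transvections n \<subseteq> T" "T \<subseteq> insert (flip_last n) (transvections n)" "T \<subseteq> K"
    and gen: "generate (AutF n) T = K"
  shows "one_ended (AutF n\<lparr>carrier := K\<rparr>)"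
    and "one_ended (AutF n\<lparr>carrier := K\<rparr> Mod Inn (free_group n))"
proof -
  interpret A: group "AutF n" by (rule group_AutF)
  let ?G = "AutF n\<lparr>carrier := K\<rparr>" and ?N = "Inn (free_group n)"
  have G: "group ?G" by (rule A.subgroup_imp_group[OF K(1)])
  have "group_hom ?G ?G (\<lambda>x. x)"
    using G by (simp add: group_hom_def group_hom_axioms_def hom_def)
  then show "one_ended ?G"
    by (rule one_ended_image[OF n K(1) _ _ T gen]) auto
  interpret N: normal ?N ?G by (rule A.normal_restrict_supergroup[OF K(1) normal_Inn K(2)])
  have "group_hom ?G (?G Mod ?N) (\<lambda>a. ?N #>\<^bsub>?G\<^esub> a)"
    using G N.factorgroup_is_group N.r_coset_hom_Mod by (simp add: group_hom_def group_hom_axioms_def)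
  then show "one_ended (?G Mod ?N)"
  proof (rule one_ended_image[OF n K(1) _ _ T gen])
    show "(\<lambda>a. ?N #>\<^bsub>?G\<^esub> a) ` K = carrier (?G Mod ?N)"
      by (auto simp: FactGroup_def RCOSETS_def)
    fix a b assume a: "a \<in> K" and b: "b \<in> K" and "?N #>\<^bsub>?G\<^esub> a = ?N #>\<^bsub>?G\<^esub> b"
    \<comment> \<open>Elements of one coset differ by an inner automorphism, whose matrix is the
      identity.\<close>
    then have "a \<in> ?N #>\<^bsub>?G\<^esub> b" using N.rcos_self[OF _ N.subgroup_axioms, of a] by simp
    then obtain k where k: "k \<in> ?N" "a = k \<otimes>\<^bsub>AutF n\<^esub> b" by (auto simp: r_coset_def)
    then have "k \<in> carrier (AutF n)" "b \<in> carrier (AutF n)"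
      using K b subgroup.mem_carrier[OF K(1)] by auto
    then show "abelianised_mat n a = abelianised_mat n b"
      using k by (simp add: abelianised_mat_mult abelianised_mat_Inn)
  qed
qed

lemma one_ended_SL_int:
  assumes n: "n \<ge> 5"
  shows "one_ended (SL_int n)"
proof (rule one_ended_image[OF n subgroup_special _ _ order_refl _ transvections_special])
  interpret A: group "AutF n" by (rule group_AutF)
  show "generate (AutF n) (transvections n) = special n" using generate_special n by simp
  show "group_hom (AutF n\<lparr>carrier := special n\<rparr>) (SL_int n) (abelianised_mat n)"
    using group_SL_int A.subgroup_imp_group[OF subgroup_special]
    by (auto simp: group_hom_def group_hom_axioms_def hom_def SL_int_def aut_sign_def abelianised_mat_mult)
  show "abelianised_mat n ` special n = carrier (SL_int n)"
  proof
    show "abelianised_mat n ` special n \<subseteq> carrier (SL_int n)"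
      by (auto simp: SL_int_def aut_sign_def)
    show "carrier (SL_int n) \<subseteq> abelianised_mat n ` special n"
      using SL_int_elementary[of n] generate_special[of n] n by simp
  qed
qed auto

theorem proposition17:
  fixes n :: nat
  assumes "n \<ge> 5"
  shows "one_ended (AutF n) \<and> one_ended (SAutF n) \<and> one_ended (OutF n) \<and>
    one_ended (SOutF n) \<and> one_ended (SL_int n)"
proof -
  interpret A: group "AutF n" by (rule group_AutF)
  have n: "n > 0" using assms by simp
  have T: "insert (flip_last n) (transvections n) \<subseteq> carrier (AutF n)"
    using transvections_AutF flip_last_AutF by blast
  have "Inn (free_group n) \<subseteq> carrier (AutF n)" using Inn_special by blast
  then have "one_ended (AutF n) \<and> one_ended (OutF n)"
    using one_ended_quotient[OF assms A.subgroup_self _ subset_insertI order_refl T generate_AutF[OF n]]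
    by (simp add: OutF_def)
  moreover have "one_ended (SAutF n) \<and> one_ended (SOutF n)"
    using one_ended_quotient[OF assms subgroup_special Inn_special order_refl subset_insertI
        transvections_special generate_special[OF n]]
    by (simp add: SAutF_def SOutF_def)
  ultimately show ?thesis using one_ended_SL_int[OF assms] by simp
qed

end
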